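(* Let $d\ge2$, $0<\alpha<1$ and $\beta>1$. Let $\{X_{\mathbf k},\mathbf k\in\mathbb Z_+^d\}$ be i.i.d. copies of $X$ with $\mathbb EX=0$, $\operatorname{Var}X=\sigma^2<\infty$ and $\mathbb E\big(|X|^{2/\alpha}(\log^+|X|)^{d-1-1/\alpha}\big)<\infty$. Let $B=\{\mathbf n\in\mathbb Z_+^d: |\mathbf n|=\lfloor i^{\beta/(1-\alpha)}\rfloor\text{ for some integer }i\ge1\}$. Then $$\limsup_{\mathbf n\to\infty,\ \mathbf n\in B}\frac{\max_{\mathbf 0\le\mathbf k\le\mathbf n^\alpha}T_{\mathbf n,\mathbf n+\mathbf k}}{\sqrt{2|\mathbf n|^\alpha\log|\mathbf n|}}=\sigma\sqrt{\frac{1-\alpha}{\beta}}\quad\text{a.s.}$$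
   Context: $\mathbb Z_+^d$ is the set of $d$-tuples of positive integers with the coordinatewise partial order $\le$; $\mathbf k$ ranges over $\mathbb Z_{\ge0}^d$. $|\mathbf n|=\prod_{k=1}^d n_k$; $\mathbf n\to\infty$ means every coordinate tends to infinity. $\mathbf n^\alpha=(\lfloor n_1^\alpha\rfloor,\dots,\lfloor n_d^\alpha\rfloor)$. $T_{\mathbf n,\mathbf n+\mathbf k}=\sum X_{\mathbf j}$ over all $\mathbf j\in\mathbb Z_+^d$ with $n_i<j_i\le n_i+k_i$ for every $i$. $\log^+x=\max\{\log x,1\}$. *)

theory Defs
  imports "HOL-Probability.Probability"
begin

text \<open>Multi-indices in Z_+^d are functions 'd => nat (with 'd a finite index type,
  d = CARD('d)) all of whose values are positive.\<close>

definition pos_idx :: "('d::finite \<Rightarrow> nat) set" where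
  "pos_idx = {n. \<forall>i. 0 < n i}"

definition absn :: "('d::finite \<Rightarrow> nat) \<Rightarrow> nat" where
  "absn n = (\<Prod>i\<in>UNIV. n i)"

definition npow :: "real \<Rightarrow> ('d::finite \<Rightarrow> nat) \<Rightarrow> ('d \<Rightarrow> nat)" where
  "npow a n = (\<lambda>i. nat \<lfloor>real (n i) powr a\<rfloor>)"

definition Tsum :: "(('d::finite \<Rightarrow> nat) \<Rightarrow> 'w \<Rightarrow> real) \<Rightarrow> ('d \<Rightarrow> nat) \<Rightarrow> ('d \<Rightarrow> nat) \<Rightarrow> 'w \<Rightarrow> real" where
  "Tsum X n k \<omega> = (\<Sum>j\<in>{j. \<forall>i. n i < j i \<and> j i \<le> n i + k i}. X j \<omega>)"

definition logplus :: "real \<Rightarrow> real" where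
  "logplus x = max (ln x) 1"

definition multi_at_top :: "('d::finite \<Rightarrow> nat) filter" where
  "multi_at_top = (INF m. principal {n. \<forall>i. m \<le> n i})"

end

theory Submission
  imports Defs "HOL-Real_Asymp.Real_Asymp"
begin

text \<open>
  Write \<open>w = (1 - \<alpha>) / \<beta>\<close>, so that the volumes in \<open>B\<close> are the numbers
  \<open>\<lfloor>i powr (1 / w)\<rfloor>\<close>.

  Upper bound: Ottaviani's inequality, applied one coordinate at a time, reduces the maximum over
  the box to the full sum, at the cost of a factor \<open>2 ^ d\<close> and a shift of the level by
  \<open>d\<close> standard deviations. Truncation and an exponential bound give a tail
  \<open>|n| powr (- w - \<delta>)\<close>; since \<open>\<beta> > 1\<close>, the moment condition leaves polynomial room for the
  truncation error. By the divisor bound each volume is attained by only \<open>|n| powr o(1)\<close>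
  indices, so the probabilities are summable.

  Lower bound: freeze all coordinates but one at a large constant \<open>m\<close>. The indices of
  \<open>B\<close> on this ray correspond to those \<open>i\<close> with \<open>m ^ (d - 1)\<close> dividing
  \<open>\<lfloor>i powr (1 / w)\<rfloor>\<close>, a set of positive density. The blocks are eventually disjoint because
  \<open>\<beta> > 1\<close>, and the central limit theorem applied to about \<open>log |n|\<close> equal pieces of a block
  bounds the tail probabilities below by a multiple of \<open>1 / i\<close>, so the second Borel-Cantelli
  argument applies.
\<close>

section \<open>Divisor bound\<close>

text \<open>A tail of order \<open>|n| powr (- \<theta>)\<close> at a volume close to
  \<open>i powr (1 / w)\<close> has size \<open>i powr (- \<theta> / w)\<close>, so its sum over
  \<open>i\<close> converges for \<theta> > w and diverges for \<theta> = w; hence the constant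
  \<open>sqrt w\<close>. Multiplicities of order \<open>|n| powr o(1)\<close> cannot move this
  threshold, which is why a crude divisor bound suffices above and a single ray suffices below.

  The obstacle is arithmetic: the exponent \<open>1 / w\<close> is an arbitrary real above 1, and it
  is not obvious that the integer parts are ever divisible by a given \<open>q\<close>. Full
  equidistribution is more than needed. Divisibility follows from a small fractional part of
  \<open>i powr (1 / w) / q\<close>, and a positive lower density of such \<open>i\<close> comes
  from a descent through iterated differences whose constants depend only on the order of the
  difference and on \<open>q\<close>.\<close>

lemma divisors_prime_power_mult:
  fixes p m :: nat
  assumes "prime p" "m > 0"
  shows "card {d. d dvd p ^ a * m} \<le> (a + 1) * card {d. d dvd m}"
proof -
  have fin: "finite {d. d dvd m}" using assms(2) by simp
  have "{d. d dvd p ^ a * m} \<subseteq> (\<lambda>(j, e). p ^ j * e) ` ({..a} \<times> {d. d dvd m})"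
  proof
    fix d assume "d \<in> {d. d dvd p ^ a * m}"
    then obtain b c where bc: "d = b * c" "b dvd p ^ a" "c dvd m"
      using division_decomp by blast
    then obtain j where "j \<le> a" "b = p ^ j"
      using divides_primepow_nat[OF assms(1)] by blast
    with bc show "d \<in> (\<lambda>(j, e). p ^ j * e) ` ({..a} \<times> {d. d dvd m})" by force
  qed
  then have "card {d. d dvd p ^ a * m} \<le> card ({..a} \<times> {d. d dvd m})"
    by (rule surj_card_le[rotated]) (use fin in auto)
  then show ?thesis by (simp add: card_cartesian_product)
qed

text \<open>Prime powers are peeled off one at a time. For a prime with
  \<open>p powr e \<ge> 2\<close> the factor \<open>a + 1 \<le> 2 ^ a\<close> is absorbed by
  \<open>p powr (a * e)\<close> at no cost; only the finitely many smaller primes cost a constant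
  \<open>K\<close> each.\<close>

lemma divisor_bound:
  fixes e :: real
  assumes "e > 0"
  obtains C where "C > 0" "\<And>m::nat. m > 0 \<Longrightarrow> real (card {d. d dvd m}) \<le> C * real m powr e"
proof -
  define c where "c = e * ln 2"
  \<comment> \<open>Chosen so that \<open>a + 1 \<le> K * (1 + a * c)\<close> for every
    \<open>a\<close>, while \<open>1 + a * c \<le> exp (a * c) = 2 powr (a * e)\<close>.\<close>
  define K where "K = 1 + 1 / c"
  have c: "c > 0" using assms by (simp add: c_def)
  have K1: "K \<ge> 1" using c by (simp add: K_def)
  obtain P :: nat where P: "real P powr e \<ge> 2"
  proof -
    obtain P :: nat where "real P \<ge> 2 powr (1 / e)" using real_arch_simple by blast
    then have "real P powr e \<ge> (2 powr (1/e)) powr e"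
      using assms by (intro powr_mono2) auto
    with that show ?thesis using assms by (simp add: powr_powr)
  qed
  \<comment> \<open>The small prime divisors of \<open>m\<close>, each charged one factor
    \<open>K\<close>; there are at most \<open>P\<close> of them, which makes the final constant
    uniform.\<close>
  define sm where "sm m = {p. p < P \<and> prime p \<and> p dvd m}" for m :: nat
  have main: "real (card {d. d dvd m}) \<le> K ^ card (sm m) * real m powr e" if "m > 0" for m :: nat
    using that
  proof (induction m rule: less_induct)
    case (less m)
    show ?case
    proof (cases "m = 1")
      case True
      then show ?thesis using K1 by (auto intro: one_le_power)
    next
      case False
      then obtain p where p: "prime p" "p dvd m" using prime_factor_nat by blast
      obtain m' where m': "m = p ^ multiplicity p m * m'" "\<not> p dvd m'"
        using multiplicity_decompose'[of m p] less.prems p not_prime_unit by (metis less_numeral_extra(3))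
      define a where "a = multiplicity p m"
      have a: "a \<ge> 1" unfolding a_def using p less.prems
        by (metis (no_types, opaque_lifting) One_nat_def a_def dvd_mult_unit_iff' m' not_less_eq_eq power_0 bot_nat_0.extremum_unique is_unit_power_iff)
      have m: "m = p ^ a * m'" using m' by (simp add: a_def)
      have p2: "p \<ge> 2" using p(1) by (rule prime_ge_2_nat)
      have m'0: "m' > 0" using less.prems m by (cases "m' = 0") auto
      have "p ^ a > 1" using a p2 by (metis One_nat_def Suc_le_lessD one_less_power prime_gt_1_nat p(1))
      then have lt: "m' < m" using m m'0 by simp
      have IH: "real (card {d. d dvd m'}) \<le> K ^ card (sm m') * real m' powr e"
        using less.IH[OF lt m'0] .
      have mp: "real m powr e = real p powr (real a * e) * real m' powr e"
        using p2 by (simp add: m powr_mult powr_powr[symmetric] powr_realpow)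
      have fin: "finite (sm m)" by (simp add: sm_def)
      have sub: "sm m' \<subseteq> sm m" by (auto simp: sm_def m)
      have step: "real (a + 1) * K ^ card (sm m') \<le> K ^ card (sm m) * real p powr (real a * e)"
      proof (cases "p < P")
        case True
        have "p \<in> sm m" "p \<notin> sm m'" using True p m' by (auto simp: sm_def)
        then have "card (sm m') < card (sm m)"
          using sub fin by (intro psubset_card_mono) auto
        then have KK: "K ^ Suc (card (sm m')) \<le> K ^ card (sm m)"
          using K1 by (intro power_increasing) auto
        have "real (a + 1) \<le> K * real p powr (real a * e)"
        proof -
          have "1 + real a * c \<le> exp (real a * c)" by (rule exp_ge_add_one_self)
          also have "\<dots> = 2 powr (real a * e)" by (simp add: powr_def c_def mult_ac)
          also have "\<dots> \<le> real p powr (real a * e)"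
            using p2 assms by (intro powr_mono2) auto
          finally have 1: "1 + real a * c \<le> real p powr (real a * e)" .
          have "real (a + 1) \<le> K * (1 + real a * c)"
            using c by (simp add: K_def field_simps)
          also have "\<dots> \<le> K * real p powr (real a * e)"
            using 1 K1 by (intro mult_left_mono) auto
          finally show ?thesis .
        qed
        then have "real (a + 1) * K ^ card (sm m') \<le> K * real p powr (real a * e) * K ^ card (sm m')"
          using K1 by (intro mult_right_mono) auto
        also have "\<dots> = K ^ Suc (card (sm m')) * real p powr (real a * e)" by simp
        also have "\<dots> \<le> K ^ card (sm m) * real p powr (real a * e)"
          using KK by (intro mult_right_mono) auto
        finally show ?thesis .
      next
        case False
        have "real (a + 1) \<le> 2 ^ a" using of_nat_mono[of "Suc a" "2 ^ a", where 'a=real]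
          by (simp add: Suc_leI)
        also have "\<dots> \<le> (real p powr e) ^ a"
          using P False assms powr_mono2[of e "real P" "real p"] by (intro power_mono) auto
        also have "\<dots> = real p powr (real a * e)"
          using p2 by (simp add: powr_power mult_ac)
        finally have "real (a + 1) \<le> real p powr (real a * e)" .
        moreover have "K ^ card (sm m') \<le> K ^ card (sm m)"
          using K1 card_mono[OF fin sub] by (intro power_increasing) auto
        ultimately show ?thesis using K1
          by (metis mult.commute mult_mono of_nat_0_le_iff order_trans zero_le_one zero_le_power powr_ge_zero)
      qed
      have "real (card {d. d dvd m}) \<le> real (a + 1) * real (card {d. d dvd m'})"
        using divisors_prime_power_mult[OF p(1) m'0, of a] m
        by (metis of_nat_le_iff of_nat_mult)
      also have "\<dots> \<le> real (a + 1) * (K ^ card (sm m') * real m' powr e)"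
        using IH by (intro mult_left_mono) auto
      also have "\<dots> = (real (a + 1) * K ^ card (sm m')) * real m' powr e" by simp
      also have "\<dots> \<le> (K ^ card (sm m) * real p powr (real a * e)) * real m' powr e"
        using step by (intro mult_right_mono) auto
      finally show ?thesis by (simp add: mp mult_ac)
    qed
  qed
  have "real (card {d. d dvd m}) \<le> K ^ P * real m powr e" if "m > 0" for m :: nat
  proof -
    have "card (sm m) \<le> P" using card_mono[of "{..<P}" "sm m"] by (auto simp: sm_def)
    then have "K ^ card (sm m) \<le> K ^ P" using K1 by (intro power_increasing)
    with main[OF that] show ?thesis by (smt (verit, best) mult_right_mono powr_ge_zero)
  qed
  then show ?thesis using that[of "K ^ P"] K1 by simp
qed

lemma finite_absn_eq:
  assumes "m > 0"
  shows "finite {n::'d::finite \<Rightarrow> nat. absn n = m}"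
    and "card {n::'d::finite \<Rightarrow> nat. absn n = m} \<le> card {d. d dvd m} ^ CARD('d)"
proof -
  have sub: "{n::'d \<Rightarrow> nat. absn n = m} \<subseteq> PiE UNIV (\<lambda>_. {d. d dvd m})"
    by (auto simp: absn_def PiE_def Pi_def)
  have fin: "finite (PiE (UNIV::'d set) (\<lambda>_. {d. d dvd m}))"
    using assms by (intro finite_PiE) auto
  show "finite {n::'d \<Rightarrow> nat. absn n = m}" by (rule finite_subset[OF sub fin])
  show "card {n::'d \<Rightarrow> nat. absn n = m} \<le> card {d. d dvd m} ^ CARD('d)"
    using card_mono[OF fin sub] by (simp add: card_PiE)
qed

lemma card_absn_bound:
  fixes e :: real
  assumes "e > 0"
  obtains C where "C > 0"
    "\<And>m::nat. m > 0 \<Longrightarrow> real (card {n::'d::finite \<Rightarrow> nat. absn n = m}) \<le> C * real m powr e"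
proof -
  have "e / real CARD('d) > 0" using assms by simp
  from divisor_bound[OF this] obtain C where C: "C > 0"
    "\<And>m::nat. m > 0 \<Longrightarrow> real (card {d. d dvd m}) \<le> C * real m powr (e / real CARD('d))"
    by blast
  have "real (card {n::'d \<Rightarrow> nat. absn n = m}) \<le> C ^ CARD('d) * real m powr e" if "m > 0" for m
  proof -
    have "real (card {n::'d \<Rightarrow> nat. absn n = m}) \<le> real (card {d. d dvd m}) ^ CARD('d)"
      using finite_absn_eq(2)[OF that, where 'd='d] by (metis of_nat_le_iff of_nat_power)
    also have "\<dots> \<le> (C * real m powr (e / real CARD('d))) ^ CARD('d)"
      using C(2)[OF that] by (intro power_mono) auto
    also have "\<dots> = C ^ CARD('d) * real m powr e"
      using that by (simp add: power_mult_distrib powr_power)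
    finally show ?thesis .
  qed
  then show ?thesis using that[of "C ^ CARD('d)"] C(1) by simp
qed

section \<open>Divisibility of the integer parts of powers\<close>

definition fdiff :: "(nat \<Rightarrow> real) \<Rightarrow> nat \<Rightarrow> real" where
  "fdiff f n = f (Suc n) - f n"

lemma fdiff_iterate_choose: "(fdiff ^^ k) (\<lambda>n. real (n choose k)) = (\<lambda>_. 1)"
proof (induction k)
  case (Suc k)
  have "fdiff (\<lambda>n. real (n choose Suc k)) = (\<lambda>n. real (n choose k))"
    by (simp add: fdiff_def fun_eq_iff)
  then show ?case using Suc by (simp add: funpow_Suc_right del: funpow.simps)
qed (simp add: fun_eq_iff)

lemma fdiff_iterate_linear:
  "(fdiff ^^ k) (\<lambda>n. f n - c * g n) n = (fdiff ^^ k) f n - c * (fdiff ^^ k) g n"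
  by (induction k arbitrary: n) (simp_all add: fdiff_def algebra_simps)

lemma fdiff_iterate_sub_choose:
  "(fdiff ^^ k) (\<lambda>n. f n - c * real (n choose k)) n = (fdiff ^^ k) f n - c"
  by (simp add: fdiff_iterate_linear fdiff_iterate_choose)

text \<open>Take the first time \<open>u\<close> at which \<open>g\<close> reaches \<mu> above the
  integer \<open>b\<close>, the ceiling of its starting value. Steps of at least \<open>lo\<close>
  bring it there within \<open>J\<close> steps. Steps of at most \<open>hi\<close> limit the
  overshoot at \<open>u\<close> plus the next \<open>R\<close> steps to
  \<open>hi * (R + 1) \<le> \<mu>\<close>, so \<open>g\<close> lingers in a window of width
  \<mu>.\<close>

lemma slow_crossing:
  fixes g :: "nat \<Rightarrow> real"
  assumes "0 < lo" "0 < \<mu>" "\<mu> \<le> 1"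
    and inc: "\<And>n. n \<in> {s..<s+J+R} \<Longrightarrow> lo \<le> fdiff g n \<and> fdiff g n \<le> hi"
    and J: "2 \<le> lo * real J" and R: "hi * real (R + 1) \<le> \<mu>"
  obtains b :: int and u where "s < u" "u \<le> s + J"
    "\<And>j. j \<le> R \<Longrightarrow> of_int b + \<mu> \<le> g (u + j) \<and> g (u + j) \<le> of_int b + 2 * \<mu>"
proof -
  define b where "b = \<lceil>g s\<rceil>"
  have low: "g s + lo * real j \<le> g (s + j)" if "j \<le> J + R" for j
    using that
  proof (induction j)
    case (Suc j)
    then show ?case using inc[of "s + j"] by (simp add: fdiff_def algebra_simps)
  qed simp
  define P where "P n \<longleftrightarrow> n \<ge> s \<and> g n \<ge> of_int b + \<mu>" for n
  \<comment> \<open>A rise of 2 is enough because \<open>b + \<mu>\<close> lies less than 2 above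
    \<open>g s\<close>.\<close>
  have "g (s + J) \<ge> g s + 2" using low[of J] J by simp
  moreover have "of_int b < g s + 1" unfolding b_def by linarith
  ultimately have PJ: "P (s + J)" using assms(3) by (simp add: P_def)
  define u where "u = (LEAST n. P n)"
  have Pu: "P u" unfolding u_def using PJ by (rule LeastI)
  have uJ: "u \<le> s + J" unfolding u_def using PJ by (rule Least_le)
  have "\<not> P s" using assms(2) unfolding P_def b_def by linarith
  then have su: "s < u" using Pu by (metis P_def le_eq_less_or_eq)
  have "\<not> P (u - 1)" using su not_less_Least[of "u - 1" P] by (simp add: u_def)
  then have "g (u - 1) < of_int b + \<mu>" using su unfolding P_def by linarith
  moreover have hi: "fdiff g (u - 1) \<le> hi" by (rule conjunct2[OF inc]) (use su uJ in auto)
  ultimately have gu: "g u \<le> of_int b + \<mu> + hi" using su by (simp add: fdiff_def)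
  have "lo \<le> fdiff g (u - 1)" by (rule conjunct1[OF inc]) (use su uJ in auto)
  then have hi0: "0 \<le> hi" using hi assms(1) by simp
  have bd: "of_int b + \<mu> \<le> g (u + j) \<and> g (u + j) \<le> of_int b + \<mu> + hi * real (j + 1)" if "j \<le> R" for j
    using that
  proof (induction j)
    case 0
    then show ?case using gu Pu by (simp add: P_def)
  next
    case (Suc j)
    then have "lo \<le> fdiff g (u + j)" "fdiff g (u + j) \<le> hi" using inc[of "u + j"] su uJ by auto
    with Suc show ?case using assms(1) by (simp add: fdiff_def algebra_simps)
  qed
  have "of_int b + \<mu> \<le> g (u + j) \<and> g (u + j) \<le> of_int b + 2 * \<mu>" if "j \<le> R" for j
  proof -
    have "hi * real (j + 1) \<le> hi * real (R + 1)" using hi0 that by (intro mult_left_mono) auto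
    then show ?thesis using bd[OF that] R by simp
  qed
  with that su uJ show ?thesis by blast
qed

text \<open>Subtracting the integer-valued polynomial \<open>a * binom n k\<close> removes the integer part of the
  \<open>k\<close>-th difference without changing fractional parts; the \<open>(k-1)\<close>-st difference then
  drifts slowly and must run through the window required one level below.\<close>

lemma frac_hit_of_difference:
  assumes "\<delta> > 0"
  obtains \<mu> T where "0 < \<mu>" "\<mu> \<le> 1"
    "\<And>f s (a::int). (\<And>n. n \<in> {s..<s+T} \<Longrightarrow> of_int a + \<mu> \<le> (fdiff ^^ k) f n \<and> (fdiff ^^ k) f n \<le> of_int a + 2 * \<mu>)
       \<Longrightarrow> \<exists>n\<in>{s..<s+T}. frac (f n) < \<delta>"
proof -
  \<comment> \<open>\<mu> and \<open>T\<close> must be chosen before \<open>f\<close>,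
    \<open>s\<close> and \<open>a\<close>: the induction replaces \<open>f\<close> by another
    sequence, and the density count needs one window length for all starting points.\<close>
  have "\<exists>\<mu> T. 0 < \<mu> \<and> \<mu> \<le> 1 \<and> (\<forall>f s (a::int).
      (\<forall>n\<in>{s..<s+T}. of_int a + \<mu> \<le> (fdiff ^^ k) f n \<and> (fdiff ^^ k) f n \<le> of_int a + 2 * \<mu>)
       \<longrightarrow> (\<exists>n\<in>{s..<s+T}. frac (f n) < \<delta>))"
  proof (induction k)
    case 0
    \<comment> \<open>One third keeps \<open>2 * \<mu>\<close> below both 1 and \<delta>, so every
      point of the window has integer part \<open>a\<close> and fractional part below
      \<delta>.\<close>
    define \<mu> where "\<mu> = min \<delta> 1 / 3"
    have *: "frac x < \<delta>" if "of_int a + \<mu> \<le> x \<and> x \<le> of_int a + 2 * \<mu>" for x and a :: int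
    proof -
      have "\<mu> > 0" "2 * \<mu> < 1" "2 * \<mu> < \<delta>" using assms by (auto simp: \<mu>_def)
      then have "\<lfloor>x\<rfloor> = a" using that by (intro floor_unique) auto
      then show ?thesis using that \<open>2 * \<mu> < \<delta>\<close> by (simp add: frac_def)
    qed
    show ?case
    proof (intro exI conjI allI impI)
      show "0 < \<mu>" "\<mu> \<le> 1" using assms by (auto simp: \<mu>_def)
      fix f s a
      assume "\<forall>n\<in>{s..<s+1}. real_of_int a + \<mu> \<le> (fdiff ^^ 0) f n \<and> (fdiff ^^ 0) f n \<le> real_of_int a + 2 * \<mu>"
      then show "\<exists>n\<in>{s..<s+1}. frac (f n) < \<delta>" using *[of a "f s"] by auto
    qed
  next
    case (Suc k)
    then obtain \<mu> T where \<mu>: "0 < \<mu>" "\<mu> \<le> 1" and hit: "\<And>f s (a::int).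
      (\<forall>n\<in>{s..<s+T}. of_int a + \<mu> \<le> (fdiff ^^ k) f n \<and> (fdiff ^^ k) f n \<le> of_int a + 2 * \<mu>)
       \<Longrightarrow> (\<exists>n\<in>{s..<s+T}. frac (f n) < \<delta>)" by blast
    \<comment> \<open>Slopes of at most \<open>2 * \<nu>\<close> over \<open>T + 1\<close> steps
      then add up to at most \<mu>, the drift that \<open>slow_crossing\<close> tolerates.\<close>
    define \<nu> where "\<nu> = \<mu> / (2 * real (T + 1))"
    have \<nu>: "0 < \<nu>" "\<nu> \<le> 1" using \<mu> by (auto simp: \<nu>_def field_simps)
    define J where "J = nat \<lceil>2 / \<nu>\<rceil>"
    have J: "2 \<le> \<nu> * real J"
    proof -
      have "2 / \<nu> \<le> real J" unfolding J_def by linarith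
      then show ?thesis using \<nu> by (simp add: field_simps)
    qed
    show ?case
    proof (intro exI conjI allI impI)
      show "0 < \<nu>" "\<nu> \<le> 1" by (fact \<nu>)+
      fix f s a
      assume f: "\<forall>n\<in>{s..<s+(J+T)}. real_of_int a + \<nu> \<le> (fdiff ^^ Suc k) f n \<and> (fdiff ^^ Suc k) f n \<le> real_of_int a + 2 * \<nu>"
      define h where "h n = f n - of_int a * real (n choose Suc k)" for n
      have dh: "fdiff ((fdiff ^^ k) h) n = (fdiff ^^ Suc k) f n - of_int a" for n
        unfolding h_def using fdiff_iterate_sub_choose[of "Suc k" f "of_int a" n] by simp
      have fr: "frac (h n) = frac (f n)" for n
      proof -
        have "frac (x + of_int z) = frac x" for x :: real and z by (simp add: frac_def)
        from this[of "f n" "- (a * int (n choose Suc k))"] show ?thesis by (simp add: h_def)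
      qed
      obtain b u where u: "s < u" "u \<le> s + J"
        "\<And>j. j \<le> T \<Longrightarrow> of_int b + \<mu> \<le> (fdiff ^^ k) h (u + j) \<and> (fdiff ^^ k) h (u + j) \<le> of_int b + 2 * \<mu>"
      proof (rule slow_crossing[of \<nu> \<mu> s J T "(fdiff ^^ k) h" "2 * \<nu>"])
        fix n assume "n \<in> {s..<s+J+T}"
        then show "\<nu> \<le> fdiff ((fdiff ^^ k) h) n \<and> fdiff ((fdiff ^^ k) h) n \<le> 2 * \<nu>"
          using bspec[OF f, of n] unfolding dh by (simp add: add.assoc)
      next
        have "2 * \<nu> * real (T + 1) = \<mu>" unfolding \<nu>_def by (simp add: field_simps)
        then show "2 * \<nu> * real (T + 1) \<le> \<mu>" by simp
      qed (use \<nu> \<mu> J that in blast)+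
      have "\<forall>n\<in>{u..<u+T}. of_int b + \<mu> \<le> (fdiff ^^ k) h n \<and> (fdiff ^^ k) h n \<le> of_int b + 2 * \<mu>"
      proof
        fix n assume "n \<in> {u..<u+T}"
        then have "n - u \<le> T" "u + (n - u) = n" by auto
        then show "of_int b + \<mu> \<le> (fdiff ^^ k) h n \<and> (fdiff ^^ k) h n \<le> of_int b + 2 * \<mu>"
          using u(3)[of "n - u"] by simp
      qed
      from hit[OF this] obtain n where "n \<in> {u..<u+T}" "frac (h n) < \<delta>" by blast
      then show "\<exists>n\<in>{s..<s+(J+T)}. frac (f n) < \<delta>"
        using u fr by (intro bexI[of _ n]) auto
    qed
  qed
  then show ?thesis using that by metis
qed

text \<open>Here \<open>D j\<close> stands for the \<open>j\<close>-th derivative, and the induction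
  generalises over the whole tower. The unit differences \<open>E j\<close> form a tower of
  derivatives again, so the induction hypothesis yields \<open>E k \<xi>\<close>, and one ordinary
  mean value step turns it into \<open>D (Suc k) z\<close>.\<close>

lemma fdiff_iterate_mean_value:
  fixes D :: "nat \<Rightarrow> real \<Rightarrow> real"
  assumes "\<And>j x. x > 0 \<Longrightarrow> (D j has_real_derivative D (Suc j) x) (at x)" and "n > 0"
  obtains \<xi> where "real n \<le> \<xi>" "\<xi> \<le> real (n + k)" "(fdiff ^^ k) (\<lambda>i. D 0 (real i)) n = D k \<xi>"
proof -
  have "\<exists>\<xi>. real n \<le> \<xi> \<and> \<xi> \<le> real (n + k) \<and> (fdiff ^^ k) (\<lambda>i. D 0 (real i)) n = D k \<xi>"
    using assms(1)
  proof (induction k arbitrary: D)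
    case 0
    then show ?case by (intro exI[of _ "real n"]) auto
  next
    case (Suc k)
    define E where "E j x = D j (x + 1) - D j x" for j x
    have "(E j has_real_derivative E (Suc j) x) (at x)" if "x > 0" for j x
    proof -
      have "((\<lambda>x. D j (x + 1)) has_real_derivative D (Suc j) (x + 1)) (at x)"
        using Suc.prems[of "x + 1" j] that by (simp add: DERIV_shift)
      then show ?thesis unfolding E_def using Suc.prems[OF that] by (intro DERIV_diff) auto
    qed
    from Suc.IH[of E, OF this] obtain \<xi> where \<xi>: "real n \<le> \<xi>" "\<xi> \<le> real (n + k)"
      "(fdiff ^^ k) (\<lambda>i. E 0 (real i)) n = E k \<xi>" by blast
    have \<xi>0: "\<xi> > 0" using \<xi>(1) assms(2) by linarith
    have "\<exists>z>\<xi>. z < \<xi> + 1 \<and> D k (\<xi> + 1) - D k \<xi> = (\<xi> + 1 - \<xi>) * D (Suc k) z"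
      using \<xi>0 by (intro MVT2 Suc.prems) auto
    then obtain z where z: "z > \<xi>" "z < \<xi> + 1" "E k \<xi> = D (Suc k) z" by (auto simp: E_def)
    have "fdiff (\<lambda>i. D 0 (real i)) = (\<lambda>i. E 0 (real i))"
      by (simp add: fun_eq_iff fdiff_def E_def add.commute)
    then show ?case using \<xi> z by (intro exI[of _ z]) (auto simp: funpow_Suc_right simp del: funpow.simps)
  qed
  then show ?thesis using that by blast
qed

text \<open>If \<open>k\<close> is the integer part of \<open>x / q\<close>, the small fractional
  part confines \<open>x\<close> to the interval from \<open>k * q\<close> to
  \<open>k * q + 1\<close>.\<close>

lemma dvd_floor_of_frac:
  fixes x :: real
  assumes "x \<ge> 0" "q > 0" "frac (x / real q) < 1 / real q"
  shows "q dvd nat \<lfloor>x\<rfloor>"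
proof -
  define k where "k = \<lfloor>x / real q\<rfloor>"
  have k: "x / real q < of_int k + 1 / real q" "of_int k \<le> x / real q"
    using assms(3) by (auto simp: frac_def k_def)
  have "x < of_int (k * int q) + 1" "of_int (k * int q) \<le> x"
    using k assms(2) by (auto simp: field_simps)
  then have fl: "\<lfloor>x\<rfloor> = k * int q" by (intro floor_unique) auto
  have "k \<ge> 0" using assms by (simp add: k_def)
  then show ?thesis unfolding fl by (simp add: nat_mult_distrib)
qed


section \<open>Lower density of the divisible indices\<close>

lemma card_blocks_ge:
  fixes H :: "nat set"
  assumes "\<And>w. w < W \<Longrightarrow> r \<le> card (H \<inter> {s + w * L..<s + Suc w * L})"
  shows "W * r \<le> card (H \<inter> {s..<s + W * L})"
  using assms
proof (induction W)
  case (Suc W)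
  have "H \<inter> {s..<s + Suc W * L} = (H \<inter> {s..<s + W * L}) \<union> (H \<inter> {s + W * L..<s + Suc W * L})"
    by auto
  also have "card \<dots> = card (H \<inter> {s..<s + W * L}) + card (H \<inter> {s + W * L..<s + Suc W * L})"
    by (intro card_Un_disjoint) auto
  moreover have "W * r \<le> card (H \<inter> {s..<s + W * L})" by (rule Suc.IH) (use Suc.prems in simp)
  ultimately show ?case using Suc.prems[of W] by simp
qed simp

text \<open>The \<open>K\<close>-th difference climbs with slope between \<open>l\<close> and
  \<open>3 * l\<close>. Within every \<open>4 / l\<close> steps it enters the window above an
  integer and stays there for about \<open>\<mu> / (3 * l)\<close> steps, which gives a number of
  hits proportional to \<open>1 / l\<close>. The slope cancels, so the density does not depend on
  \<open>N\<close>. The product \<open>N * lam N\<close> must tend to infinity for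
  \<open>{N..<2*N}\<close> to contain many such periods.\<close>

lemma dense_of_slow_difference:
  fixes f :: "nat \<Rightarrow> real" and lam :: "nat \<Rightarrow> real"
  assumes "\<delta> > 0"
    and pos: "\<And>N. lam N > 0" and lim: "lam \<longlonglongrightarrow> 0"
    and big: "filterlim (\<lambda>N. real N * lam N) at_top sequentially"
    and diff: "\<forall>\<^sub>F N in sequentially. \<forall>n\<in>{N..<2*N}. lam N \<le> (fdiff ^^ Suc K) f n \<and> (fdiff ^^ Suc K) f n \<le> 3 * lam N"
  obtains c where "c > 0"
    "\<forall>\<^sub>F N in sequentially. c * real N \<le> real (card ({n. frac (f n) < \<delta>} \<inter> {N..<2*N}))"
proof -
  obtain \<mu> T where \<mu>: "0 < \<mu>" "\<mu> \<le> 1" and hit: 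
    "\<And>f s (a::int). (\<And>n. n \<in> {s..<s+T} \<Longrightarrow> of_int a + \<mu> \<le> (fdiff ^^ K) f n \<and> (fdiff ^^ K) f n \<le> of_int a + 2 * \<mu>)
       \<Longrightarrow> \<exists>n\<in>{s..<s+T}. frac (f n) < \<delta>"
    using frac_hit_of_difference[OF assms(1), of K] by metis
  \<comment> \<open>For \<open>T = 0\<close> the premise of \<open>hit\<close> is vacuous and its
    conclusion would put an element into an empty interval.\<close>
  have T: "T > 0" using hit[of 0] by (cases "T = 0") auto
  define H where "H = {n. frac (f n) < \<delta>}"
  \<comment> \<open>The product of the two counts below, divided by \<open>N\<close>: at least
    \<open>N * l / 8\<close> periods with at least \<open>\<mu> / (6 * l * T)\<close> hits
    each.\<close>
  define c where "c = \<mu> / (48 * real T)"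
  have "\<forall>\<^sub>F N in sequentially. lam N < \<mu> / (6 * real (T + 1))"
    using order_tendstoD(2)[OF lim] \<mu> by simp
  moreover have "\<forall>\<^sub>F N in sequentially. lam N < 1" using order_tendstoD(2)[OF lim] by simp
  moreover have "\<forall>\<^sub>F N in sequentially. real N * lam N \<ge> 8"
    using big by (simp add: filterlim_at_top)
  ultimately have "\<forall>\<^sub>F N in sequentially. c * real N \<le> real (card (H \<inter> {N..<2*N}))"
    using diff
  proof eventually_elim
    case (elim N)
    define l where "l = lam N"
    have l: "l > 0" "l < 1" "l < \<mu> / (6 * real (T + 1))" "real N * l \<ge> 8"
      using pos elim by (auto simp: l_def)
    \<comment> \<open>At slope \<open>3 * l\<close> the window of width \<mu> holds \<open>R\<close>
      further steps as soon as \<open>3 * l * (R + 1) \<le> \<mu>\<close>; \<open>r\<close> is the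
      number of disjoint stretches of length \<open>T\<close> that fit into this stay.\<close>
    define r where "r = nat \<lfloor>(\<mu> / (3 * l) - 1) / real T\<rfloor>"
    define R where "R = r * T"
    define J where "J = nat \<lceil>2 / l\<rceil>"
    define L where "L = J + R"
    define W where "W = N div L"
    have l6: "\<mu> / (6 * l) \<ge> real T + 1" using l by (simp add: field_simps)
    then have "\<mu> / (3 * l) - 1 \<ge> 0" by simp
    then have nn: "(\<mu> / (3 * l) - 1) / real T \<ge> 0" by simp
    have r_le: "real r \<le> (\<mu> / (3 * l) - 1) / real T" unfolding r_def using nn by linarith
    have "real r \<ge> (\<mu> / (3 * l) - 1) / real T - 1" unfolding r_def using nn by linarith
    moreover have "(\<mu> / (3 * l) - 1) / real T - 1 = (\<mu> / (3 * l) - 1 - real T) / real T"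
      using T by (simp add: field_simps)
    moreover have "\<dots> \<ge> (\<mu> / (6 * l)) / real T"
      using T l6 by (intro divide_right_mono) auto
    ultimately have r_ge: "real r \<ge> \<mu> / (6 * l) / real T" by simp
    have R_le: "real R \<le> \<mu> / (3 * l) - 1" using r_le T by (simp add: R_def field_simps)
    have J_ge: "2 \<le> l * real J"
    proof -
      have "2 / l \<le> real J" unfolding J_def by linarith
      then show ?thesis using l by (simp add: field_simps)
    qed
    have "real J \<le> 2 / l + 1" unfolding J_def using l by (smt (verit) of_nat_nat of_int_ceiling_le_add_one divide_nonneg_pos zero_le_ceiling)
    moreover have "1 \<le> 1 / l" using l by simp
    moreover have "\<mu> / (3 * l) \<le> 1 / l" using l \<mu> by (simp add: field_simps)
    ultimately have L_le: "real L \<le> 4 / l" using R_le by (simp add: L_def)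
    have L0: "L > 0" using J_ge by (cases "J = 0") (auto simp: L_def)
    have win: "r \<le> card (H \<inter> {s..<s+L})" if sub: "{s..<s+L} \<subseteq> {N..<2*N}" for s
    proof -
      obtain b u where u: "s < u" "u \<le> s + J"
        "\<And>j. j \<le> R \<Longrightarrow> of_int b + \<mu> \<le> (fdiff ^^ K) f (u + j) \<and> (fdiff ^^ K) f (u + j) \<le> of_int b + 2 * \<mu>"
      proof (rule slow_crossing[of l \<mu> s J R "(fdiff ^^ K) f" "3 * l"])
        fix n assume "n \<in> {s..<s+J+R}"
        then have "n \<in> {N..<2*N}" using subsetD[OF sub, of n] by (simp add: L_def add.assoc)
        then show "l \<le> fdiff ((fdiff ^^ K) f) n \<and> fdiff ((fdiff ^^ K) f) n \<le> 3 * l"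
          using elim by (simp add: l_def)
      next
        show "3 * l * real (R + 1) \<le> \<mu>" using R_le l by (simp add: field_simps)
      qed (use l \<mu> J_ge in auto)
      have "r * 1 \<le> card (H \<inter> {u..<u + r * T})"
      proof (rule card_blocks_ge)
        fix w assume w: "w < r"
        have "Suc w * T \<le> R" unfolding R_def using w by (intro mult_right_mono) auto
        then have R': "w * T + T \<le> R" by simp
        have "\<exists>n\<in>{u + w * T..<u + w * T + T}. frac (f n) < \<delta>"
        proof (rule hit[of _ b])
          fix n assume "n \<in> {u + w * T..<u + w * T + T}"
          then have "n - u \<le> R" "u + (n - u) = n" using R' by auto
          then show "of_int b + \<mu> \<le> (fdiff ^^ K) f n \<and> (fdiff ^^ K) f n \<le> of_int b + 2 * \<mu>"
            using u(3)[of "n - u"] by simp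
        qed
        then obtain n where "n \<in> H" "n \<in> {u + w * T..<u + w * T + T}" by (auto simp: H_def)
        then have "n \<in> H \<inter> {u + w * T..<u + Suc w * T}" by auto
        then show "1 \<le> card (H \<inter> {u + w * T..<u + Suc w * T})"
          by (metis One_nat_def Suc_leI card_gt_0_iff empty_iff finite_Int finite_atLeastLessThan)
      qed
      also have "\<dots> \<le> card (H \<inter> {s..<s+L})"
        using u(1,2) by (intro card_mono) (auto simp: L_def R_def)
      finally show ?thesis by simp
    qed
    have WL: "W * L \<le> N" by (simp add: W_def)
    have "W * r \<le> card (H \<inter> {N..<N + W * L})"
    proof (rule card_blocks_ge)
      fix w assume w: "w < W"
      have "Suc w * L \<le> W * L" using w by (intro mult_right_mono) auto
      then have "{N + w * L..<N + w * L + L} \<subseteq> {N..<2*N}" using WL by auto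
      from win[OF this] show "r \<le> card (H \<inter> {N + w * L..<N + Suc w * L})"
        by (simp add: add.commute add.left_commute)
    qed
    also have "\<dots> \<le> card (H \<inter> {N..<2*N})" using WL by (intro card_mono) auto
    finally have cnt: "real W * real r \<le> real (card (H \<inter> {N..<2*N}))"
      by (metis of_nat_le_iff of_nat_mult)
    have "real N * l / 8 \<le> real W"
    proof -
      have "real N < real (W + 1) * real L"
        unfolding W_def using L0 by (metis dividend_less_div_times mult.commute of_nat_less_iff of_nat_mult Suc_eq_plus1 add.commute mult_Suc)
      also have "\<dots> \<le> real (W + 1) * (4 / l)" using L_le by (intro mult_left_mono) auto
      finally have "real N * l < 4 * real W + 4" using l by (simp add: field_simps)
      then show ?thesis using l(4) by simp
    qed
    then have "(real N * l / 8) * (\<mu> / (6 * l) / real T) \<le> real W * real r"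
      using r_ge l \<mu> by (intro mult_mono) auto
    moreover have "(real N * l / 8) * (\<mu> / (6 * l) / real T) = c * real N"
      using l T by (simp add: c_def field_simps)
    ultimately show ?case using cnt by simp
  qed
  moreover have "c > 0" using \<mu> T by (simp add: c_def)
  ultimately show ?thesis using that unfolding H_def by blast
qed

lemma dense_dvd_floor_powr:
  fixes \<gamma> :: real and q :: nat
  assumes "\<gamma> > 0" "q > 0"
  obtains c where "c > 0"
    "\<forall>\<^sub>F N in sequentially. c * real N \<le> real (card ({i. q dvd nat \<lfloor>real i powr \<gamma>\<rfloor>} \<inter> {N..<2*N}))"
proof -
  define K where "K = nat \<lfloor>\<gamma>\<rfloor>"
  have K: "real K \<le> \<gamma>" "\<gamma> < real K + 1" using assms by (auto simp: K_def)
  show ?thesis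
  proof (cases "\<gamma> = real K")
    \<comment> \<open>For an integer exponent every positive multiple of \<open>q\<close> works,
      whereas the difference of order \<open>K + 1\<close> would vanish identically.\<close>
    case True
    then have K0: "K > 0" using assms by (cases K) auto
    define H where "H = {i. q dvd nat \<lfloor>real i powr \<gamma>\<rfloor>}"
    have H: "i \<in> H" if "q dvd i" "i > 0" for i
    proof -
      have "real i powr \<gamma> = real (i ^ K)" using True that by (simp add: powr_realpow)
      then have "nat \<lfloor>real i powr \<gamma>\<rfloor> = i ^ K" by (metis floor_of_nat nat_int)
      moreover have "q dvd i ^ K" using that K0 by (metis dvd_power dvd_trans)
      ultimately show ?thesis by (simp add: H_def)
    qed
    have "1 / (2 * real q) * real N \<le> real (card (H \<inter> {N..<2*N}))" if "N \<ge> 2 * q" for N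
    proof -
      have "(N div q) * 1 \<le> card (H \<inter> {N..<N + (N div q) * q})"
      proof (rule card_blocks_ge)
        fix w
        define a where "a = N + w * q"
        have "a > 0" using that assms by (simp add: a_def)
        obtain b r where br: "a = q * b + r" "r < q"
          using assms by (metis mod_less_divisor mult_div_mod_eq)
        have "(if r = 0 then a else q * b + q) \<in> {a..<a + q}"
          using br assms by auto
        moreover have "q dvd (if r = 0 then a else q * b + q)" using br by simp
        ultimately have "\<exists>i\<in>{a..<a + q}. q dvd i" by blast
        then obtain i where "i \<in> {a..<a + q}" "q dvd i" by blast
        moreover have "i \<in> H" by (rule H) (use calculation \<open>a > 0\<close> in auto)
        ultimately have "i \<in> H \<inter> {N + w * q..<N + Suc w * q}" by (auto simp: a_def)
        then show "1 \<le> card (H \<inter> {N + w * q..<N + Suc w * q})"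
          by (metis One_nat_def Suc_leI card_gt_0_iff empty_iff finite_Int finite_atLeastLessThan)
      qed
      also have "\<dots> \<le> card (H \<inter> {N..<2*N})"
      proof -
        have "N + N div q * q \<le> 2 * N" by simp
        then have "{N..<N + N div q * q} \<subseteq> {N..<2*N}" by (rule ivl_subset[THEN iffD2, OF disjI2, OF conjI[OF order_refl]])
        then show ?thesis by (intro card_mono Int_mono) auto
      qed
      finally have 1: "real (N div q) \<le> real (card (H \<inter> {N..<2*N}))" by simp
      have "real N / real q < real (N div q) + 1"
      proof -
        have "real (N div q) = of_int \<lfloor>real N / real q\<rfloor>" by (simp only: floor_divide_of_nat_eq of_int_of_nat_eq)
        then show ?thesis by linarith
      qed
      moreover have "real N / real q \<ge> 2"
      proof -
        have "real (2 * q) \<le> real N" using that by (simp only: of_nat_le_iff)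
        then show ?thesis using assms(2) by (simp add: le_divide_eq)
      qed
      ultimately have "real N / real q / 2 \<le> real (N div q)" by simp
      with 1 show ?thesis by (simp add: field_simps)
    qed
    then have "\<forall>\<^sub>F N in sequentially. 1 / (2 * real q) * real N \<le> real (card (H \<inter> {N..<2*N}))"
      by (auto simp: eventually_sequentially)
    then show ?thesis using that[of "1 / (2 * real q)"] assms by (simp add: H_def)
  next
    case False
    \<comment> \<open>With \<kappa> strictly between 0 and 1 the derivative of order
      \<open>K + 1\<close> decays, but more slowly than \<open>1 / N\<close>, as the descent
      requires.\<close>
    define \<kappa> where "\<kappa> = real K + 1 - \<gamma>"
    have \<kappa>: "0 < \<kappa>" "\<kappa> < 1" using K False by (auto simp: \<kappa>_def)
    define D where "D j x = (\<Prod>l<j. \<gamma> - real l) * x powr (\<gamma> - real j) / real q" for j :: nat and x :: real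
    have D: "(D j has_real_derivative D (Suc j) x) (at x)" if "x > 0" for j x
    proof -
      have "((\<lambda>x. x powr (\<gamma> - real j)) has_real_derivative (\<gamma> - real j) * x powr (\<gamma> - real j - 1)) (at x)"
        using that by (rule has_real_derivative_powr)
      from DERIV_cmult[OF this, of "(\<Prod>l<j. \<gamma> - real l) / real q"]
      show ?thesis unfolding D_def by (simp add: diff_diff_eq algebra_simps diff_divide_distrib)
    qed
    define C where "C = (\<Prod>l<Suc K. \<gamma> - real l) / real q"
    have C: "C > 0" unfolding C_def
    proof (intro divide_pos_pos prod_pos)
      fix l assume "l \<in> {..<Suc K}"
      then have "real l \<le> real K" by simp
      then show "0 < \<gamma> - real l" using K False by simp
    qed (use assms in auto)
    \<comment> \<open>For large \<open>N\<close> the differences on \<open>{N..<2*N}\<close> are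
      derivative values at points between \<open>N\<close> and \<open>3 * N\<close>, so
      \<open>3 powr \<kappa> \<le> 3\<close> bounds them by three times the value at
      \<open>3 * N\<close>. The \<open>max\<close> keeps \<open>lam 0\<close> positive.\<close>
    define lam where "lam N = C * (3 * real (max N 1)) powr (- \<kappa>)" for N :: nat
    have DK: "D (Suc K) x = C * x powr (- \<kappa>)" for x
      by (simp add: D_def C_def \<kappa>_def algebra_simps)
    define f where "f i = real i powr \<gamma> / real q" for i :: nat
    have f: "f = (\<lambda>i. D 0 (real i))" by (simp add: f_def D_def fun_eq_iff)
    have "lam N \<le> (fdiff ^^ Suc K) f n \<and> (fdiff ^^ Suc K) f n \<le> 3 * lam N"
      if "N \<ge> K + 1" "n \<in> {N..<2*N}" for N n
    proof -
      have n0: "n > 0" using that by auto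
      obtain \<xi> where \<xi>: "real n \<le> \<xi>" "\<xi> \<le> real (n + Suc K)" "(fdiff ^^ Suc K) f n = D (Suc K) \<xi>"
        using fdiff_iterate_mean_value[of D n "Suc K"] D n0 unfolding f by metis
      have N1: "real (max N 1) = real N" using that by auto
      have "real (n + Suc K) \<le> real (3 * N)" using that by (intro of_nat_mono) auto
      then have b: "real N \<le> \<xi>" "\<xi> \<le> 3 * real N" "real N > 0" using \<xi> that by auto
      have lo: "(3 * real N) powr (- \<kappa>) \<le> \<xi> powr (- \<kappa>)"
        using b \<kappa> by (intro powr_mono2') auto
      have "\<xi> powr (- \<kappa>) \<le> real N powr (- \<kappa>)" using b \<kappa> by (intro powr_mono2') auto
      also have "\<dots> = 3 powr \<kappa> * (3 * real N) powr (- \<kappa>)"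
        using b by (simp add: powr_mult powr_minus)
      also have "\<dots> \<le> 3 powr 1 * (3 * real N) powr (- \<kappa>)"
        using \<kappa> by (intro mult_right_mono powr_mono) auto
      finally have hi: "\<xi> powr (- \<kappa>) \<le> 3 * (3 * real N) powr (- \<kappa>)" by simp
      show ?thesis unfolding \<xi>(3) DK lam_def N1
        using lo hi C by (auto intro: mult_left_mono)
    qed
    then have ev: "\<forall>\<^sub>F N in sequentially. \<forall>n\<in>{N..<2*N}. lam N \<le> (fdiff ^^ Suc K) f n \<and> (fdiff ^^ Suc K) f n \<le> 3 * lam N"
      unfolding eventually_sequentially by blast
    have ev1: "\<forall>\<^sub>F N in sequentially. C * (3 * real N) powr (- \<kappa>) = lam N"
      using eventually_ge_at_top[of 1] by eventually_elim (simp add: lam_def)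
    have "(\<lambda>N. C * (3 * real N) powr (- \<kappa>)) \<longlonglongrightarrow> 0" using \<kappa> C by real_asymp
    then have lim: "lam \<longlonglongrightarrow> 0" by (rule Lim_transform_eventually[OF _ ev1])
    have big': "filterlim (\<lambda>N. real N * (C * (3 * real N) powr (- \<kappa>))) at_top sequentially"
      using \<kappa> C by real_asymp
    have "\<forall>\<^sub>F N in sequentially. real N * (C * (3 * real N) powr (- \<kappa>)) = real N * lam N"
      using ev1 by eventually_elim simp
    from filterlim_cong[OF refl refl this] have big: "filterlim (\<lambda>N. real N * lam N) at_top sequentially"
      using big' by simp
    have q: "1 / real q > 0" using assms by simp
    have lam0: "lam N > 0" for N using C by (simp add: lam_def)
    obtain c where c: "c > 0"
      "\<forall>\<^sub>F N in sequentially. c * real N \<le> real (card ({n. frac (f n) < 1 / real q} \<inter> {N..<2*N}))"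
      by (rule dense_of_slow_difference[OF q lam0 lim big ev])
    from c(2) have "\<forall>\<^sub>F N in sequentially. c * real N \<le> real (card ({i. q dvd nat \<lfloor>real i powr \<gamma>\<rfloor>} \<inter> {N..<2*N}))"
    proof eventually_elim
      case (elim N)
      have "card ({n. frac (f n) < 1 / real q} \<inter> {N..<2*N}) \<le> card ({i. q dvd nat \<lfloor>real i powr \<gamma>\<rfloor>} \<inter> {N..<2*N})"
        using assms by (intro card_mono) (auto simp: f_def intro: dvd_floor_of_frac)
      then show ?case using elim by linarith
    qed
    with c(1) that show ?thesis by blast
  qed
qed

text \<open>For large \<open>N\<close> the block \<open>{N..<2*N}\<close> holds at least
  \<open>c * N\<close> divisible indices of weight at least \<open>1 / (2 * N)\<close>, so blocks of
  mass \<open>c / 2\<close> persist and the Cauchy criterion fails.\<close>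

lemma not_summable_dvd_floor_powr:
  fixes \<gamma> :: real and q :: nat
  assumes "\<gamma> > 0" "q > 0"
  shows "\<not> summable (\<lambda>i. if q dvd nat \<lfloor>real i powr \<gamma>\<rfloor> then 1 / real i else 0)"
proof
  define H where "H = {i. q dvd nat \<lfloor>real i powr \<gamma>\<rfloor>}"
  define a where "a i = (if i \<in> H then 1 / real i else 0)" for i
  assume "summable (\<lambda>i. if q dvd nat \<lfloor>real i powr \<gamma>\<rfloor> then 1 / real i else 0)"
  then have "summable a" by (simp add: a_def[abs_def] H_def)
  obtain c where c: "c > 0" "\<forall>\<^sub>F N in sequentially. c * real N \<le> real (card (H \<inter> {N..<2*N}))"
    using dense_dvd_floor_powr[OF assms] unfolding H_def by blast
  from c(2) obtain N0 where N0: "\<And>N. N \<ge> N0 \<Longrightarrow> c * real N \<le> real (card (H \<inter> {N..<2*N}))"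
    by (auto simp: eventually_sequentially)
  from \<open>summable a\<close> obtain N1 where N1: "\<And>m n. m \<ge> N1 \<Longrightarrow> \<bar>sum a {m..<n}\<bar> < c / 2"
    using c(1) unfolding summable_Cauchy by (metis half_gt_zero real_norm_def)
  define N where "N = max (max N0 N1) 1"
  have N: "N \<ge> N0" "N \<ge> N1" "N > 0" by (auto simp: N_def)
  have "c / 2 = c * real N * (1 / (2 * real N))" using N by simp
  also have "\<dots> \<le> real (card (H \<inter> {N..<2*N})) * (1 / (2 * real N))"
    using N0[OF N(1)] by (intro mult_right_mono) auto
  also have "\<dots> = (\<Sum>i\<in>H \<inter> {N..<2*N}. 1 / (2 * real N))" by simp
  also have "\<dots> \<le> (\<Sum>i\<in>H \<inter> {N..<2*N}. 1 / real i)"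
    using N by (intro sum_mono) (auto intro!: divide_left_mono)
  also have "\<dots> = sum a {N..<2*N}"
    by (auto simp: a_def sum.If_cases Int_commute)
  finally show False using N1[OF N(2), of "2 * N"] by linarith
qed

section \<open>Sums of independent identically distributed variables\<close>

text \<open>Restricting \<open>X\<close> to \<open>A\<close> and to \<open>B\<close> turns events
  about disjoint sets of coordinates into preimages under two independent random elements of product
  spaces.\<close>

lemma (in prob_space) prob_indep_restrict:
  assumes "indep_vars N X I" "A \<inter> B = {}" "A \<subseteq> I" "B \<subseteq> I"
    and [measurable]: "Measurable.pred (PiM A N) P" "Measurable.pred (PiM B N) Q"
  shows "prob {\<omega>\<in>space M. P (\<lambda>i\<in>A. X i \<omega>) \<and> Q (\<lambda>i\<in>B. X i \<omega>)}
    = prob {\<omega>\<in>space M. P (\<lambda>i\<in>A. X i \<omega>)} * prob {\<omega>\<in>space M. Q (\<lambda>i\<in>B. X i \<omega>)}"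
proof -
  have ind: "indep_var (PiM A N) (\<lambda>\<omega>. \<lambda>i\<in>A. X i \<omega>) (PiM B N) (\<lambda>\<omega>. \<lambda>i\<in>B. X i \<omega>)"
    using assms by (intro indep_var_restrict) auto
  have sp: "(\<lambda>i\<in>A. X i \<omega>) \<in> space (PiM A N)" "(\<lambda>i\<in>B. X i \<omega>) \<in> space (PiM B N)" if "\<omega> \<in> space M" for \<omega>
    using that measurable_space[OF indep_var_rv1[OF ind]] measurable_space[OF indep_var_rv2[OF ind]] by auto
  have "{x \<in> space (PiM A N). P x} \<in> sets (PiM A N)" "{x \<in> space (PiM B N). Q x} \<in> sets (PiM B N)"
    by measurable
  from indep_varD[OF ind this] show ?thesis
    by (rule box_equals) (auto intro!: arg_cong[where f=prob] arg_cong2[where f="(*)"] sp)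
qed

text \<open>Ottaviani's inequality in abstract form: the events \<open>G p\<close> are visited in the order given
  by the injective rank \<open>r\<close>, and the first one to occur is followed by \<open>H p\<close>
  with probability at least one half.\<close>

lemma (in prob_space) first_occurrence_bound:
  fixes r :: "'p \<Rightarrow> nat"
  assumes "finite P" "inj_on r P"
    and [measurable]: "\<And>p. p \<in> P \<Longrightarrow> G p \<in> events" "\<And>p. p \<in> P \<Longrightarrow> H p \<in> events"
    and half: "\<And>p. p \<in> P \<Longrightarrow>
      prob (G p - (\<Union>p'\<in>{p'\<in>P. r p' < r p}. G p')) \<le> 2 * prob ((G p - (\<Union>p'\<in>{p'\<in>P. r p' < r p}. G p')) \<inter> H p)"
  shows "prob (\<Union>p\<in>P. G p) \<le> 2 * prob (\<Union>p\<in>P. G p \<inter> H p)"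
proof -
  define D where "D p = G p - (\<Union>p'\<in>{p'\<in>P. r p' < r p}. G p')" for p
  have D[measurable]: "D p \<in> events" if "p \<in> P" for p
    unfolding D_def using assms(1) that by (intro sets.Diff sets.finite_UN) auto
  have disj: "disjoint_family_on D P"
  proof (unfold disjoint_family_on_def, intro ballI impI)
    fix m n assume mn: "m \<in> P" "n \<in> P" "m \<noteq> n"
    then have "r m < r n \<or> r n < r m" using assms(2) by (metis inj_onD linorder_neqE_nat)
    then show "D m \<inter> D n = {}" using mn unfolding D_def by blast
  qed
  have cover: "(\<Union>p\<in>P. G p) \<subseteq> (\<Union>p\<in>P. D p)"
  proof
    fix x assume "x \<in> (\<Union>p\<in>P. G p)"
    then obtain p0 where p0: "p0 \<in> P \<and> x \<in> G p0" by blast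
    define p where "p = (ARG_MIN r p. p \<in> P \<and> x \<in> G p)"
    have "p \<in> P \<and> x \<in> G p" "\<And>p'. p' \<in> P \<and> x \<in> G p' \<Longrightarrow> r p \<le> r p'"
      unfolding p_def using arg_min_nat_lemma[of "\<lambda>p. p \<in> P \<and> x \<in> G p", OF p0] by auto
    then have "x \<in> D p" unfolding D_def by fastforce
    then show "x \<in> (\<Union>p\<in>P. D p)" using \<open>p \<in> P \<and> x \<in> G p\<close> by blast
  qed
  have "prob (\<Union>p\<in>P. G p) \<le> prob (\<Union>p\<in>P. D p)"
    using cover assms(1) by (intro finite_measure_mono) auto
  also have "\<dots> = (\<Sum>p\<in>P. prob (D p))"
    using disj assms(1) by (intro finite_measure_finite_Union) auto
  also have "\<dots> \<le> (\<Sum>p\<in>P. 2 * prob (D p \<inter> H p))"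
    using half unfolding D_def by (intro sum_mono) auto
  also have "\<dots> = 2 * (\<Sum>p\<in>P. prob (D p \<inter> H p))" by (simp add: sum_distrib_left)
  also have "(\<Sum>p\<in>P. prob (D p \<inter> H p)) = prob (\<Union>p\<in>P. D p \<inter> H p)"
    using disj assms(1)
    by (intro finite_measure_finite_Union[symmetric]) (auto simp: disjoint_family_on_def)
  also have "\<dots> \<le> prob (\<Union>p\<in>P. G p \<inter> H p)"
    using assms(1) by (intro finite_measure_mono sets.finite_UN) (auto simp: D_def)
  finally show ?thesis by simp
qed

text \<open>For negative \<open>y\<close> the third-order Taylor remainder is not positive, so no
  exponential factor appears. This is what allows truncation from above only: large negative values
  cost no more than their second moment.\<close>

lemma exp_le_quadratic: "exp (y::real) \<le> 1 + y + y\<^sup>2 / 2 * exp (max y 0)"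
proof (cases "y \<ge> 0")
  case True
  obtain t where t: "\<bar>t\<bar> \<le> \<bar>y\<bar>" "exp y = (\<Sum>m<2. y ^ m / fact m) + exp t / fact 2 * y ^ 2"
    using Maclaurin_exp_le[of y 2] by auto
  have "exp t \<le> exp (max y 0)" using t(1) True by simp
  then have "exp t * (y\<^sup>2 / 2) \<le> exp (max y 0) * (y\<^sup>2 / 2)" by (intro mult_right_mono) auto
  then show ?thesis using t(2) by (simp add: numeral_2_eq_2 mult_ac)
next
  case False
  obtain t where t: "exp y = (\<Sum>m<3. y ^ m / fact m) + exp t / fact 3 * y ^ 3"
    using Maclaurin_exp_le[of y 3] by auto
  have "y ^ 3 \<le> 0" using False by (simp add: power_le_zero_eq)
  then have "exp t / fact 3 * y ^ 3 \<le> 0" by (intro mult_nonneg_nonpos) auto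
  then show ?thesis using t False by (simp add: numeral_3_eq_3 numeral_2_eq_2)
qed

section \<open>Moments and upper tails of sums over finite index sets\<close>

locale iid_family = prob_space M for M :: "'w measure" +
  fixes X :: "'i \<Rightarrow> 'w \<Rightarrow> real" and I :: "'i set" and X0 :: "'w \<Rightarrow> real"
  assumes X0_meas[measurable]: "X0 \<in> borel_measurable M"
    and indep: "indep_vars (\<lambda>_. borel) X I"
    and ident: "\<And>j. j \<in> I \<Longrightarrow> distr M borel (X j) = distr M borel X0"
    and integrable_X0: "integrable M X0" and mean_X0: "expectation X0 = 0"
    and integrable_square_X0: "integrable M (\<lambda>\<omega>. (X0 \<omega>)\<^sup>2)"
begin

lemma X_meas[measurable (raw)]: "j \<in> I \<Longrightarrow> X j \<in> borel_measurable M"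
  using indep by (simp add: indep_vars_def)

lemma integrable_comp_iff:
  fixes h :: "real \<Rightarrow> real"
  assumes "j \<in> I" and [measurable]: "h \<in> borel_measurable borel"
  shows "integrable M (\<lambda>\<omega>. h (X j \<omega>)) \<longleftrightarrow> integrable M (\<lambda>\<omega>. h (X0 \<omega>))"
  using integrable_distr_eq[of "X j" M borel h] integrable_distr_eq[of X0 M borel h] X_meas[OF assms(1)]
  by (simp add: ident[OF assms(1)])

lemma expectation_comp:
  fixes h :: "real \<Rightarrow> real"
  assumes "j \<in> I" and [measurable]: "h \<in> borel_measurable borel"
  shows "expectation (\<lambda>\<omega>. h (X j \<omega>)) = expectation (\<lambda>\<omega>. h (X0 \<omega>))"
  using integral_distr[of "X j" M borel h] integral_distr[of X0 M borel h] X_meas[OF assms(1)]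
  by (simp add: ident[OF assms(1)])

lemma prob_comp:
  assumes "j \<in> I" and [measurable]: "Measurable.pred borel P"
  shows "prob {\<omega>\<in>space M. P (X j \<omega>)} = prob {\<omega>\<in>space M. P (X0 \<omega>)}"
proof -
  have "prob {\<omega>\<in>space M. P (X j \<omega>)} = measure (distr M borel (X j)) {x. P x}"
    using X_meas[OF assms(1)] by (subst measure_distr) (auto intro!: arg_cong[where f=prob])
  also have "\<dots> = prob {\<omega>\<in>space M. P (X0 \<omega>)}"
    unfolding ident[OF assms(1)] by (subst measure_distr) (auto intro!: arg_cong[where f=prob])
  finally show ?thesis .
qed

abbreviation S :: "'i set \<Rightarrow> 'w \<Rightarrow> real" where
  "S J \<omega> \<equiv> (\<Sum>j\<in>J. X j \<omega>)"

definition v :: real where "v = expectation (\<lambda>\<omega>. (X0 \<omega>)\<^sup>2)"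

lemma v_nonneg: "0 \<le> v" unfolding v_def by (simp add: integral_nonneg_AE)

lemma S_meas: "J \<subseteq> I \<Longrightarrow> S J \<in> borel_measurable M"
  by (intro borel_measurable_sum) (auto intro: X_meas)

lemma second_moment_sum:
  assumes "finite J" "J \<subseteq> I"
  shows "integrable M (S J)" "expectation (S J) = 0"
    "integrable M (\<lambda>\<omega>. (S J \<omega>)\<^sup>2)" "expectation (\<lambda>\<omega>. (S J \<omega>)\<^sup>2) = real (card J) * v"
proof -
  have X1: "integrable M (X j)" "expectation (X j) = 0" "integrable M (\<lambda>\<omega>. (X j \<omega>)\<^sup>2)"
    "expectation (\<lambda>\<omega>. (X j \<omega>)\<^sup>2) = v" if "j \<in> I" for j
    using integrable_comp_iff[OF that, of "\<lambda>x. x"] expectation_comp[OF that, of "\<lambda>x. x"]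
      integrable_comp_iff[OF that, of "\<lambda>x. x\<^sup>2"] expectation_comp[OF that, of "\<lambda>x. x\<^sup>2"]
      integrable_X0 mean_X0 integrable_square_X0 by (auto simp: v_def)
  have "integrable M (S J) \<and> expectation (S J) = 0 \<and>
    integrable M (\<lambda>\<omega>. (S J \<omega>)\<^sup>2) \<and> expectation (\<lambda>\<omega>. (S J \<omega>)\<^sup>2) = real (card J) * v"
    using assms
  proof (induction J)
    case (insert j J)
    then have j: "j \<in> I" "finite J" "j \<notin> J" and IH: "integrable M (S J)" "expectation (S J) = 0"
      "integrable M (\<lambda>\<omega>. (S J \<omega>)\<^sup>2)" "expectation (\<lambda>\<omega>. (S J \<omega>)\<^sup>2) = real (card J) * v" by auto
    have ind: "indep_var borel (X j) borel (S J)"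
      using insert.prems j by (intro indep_vars_sum indep_vars_subset[OF indep]) auto
    have prod: "integrable M (\<lambda>\<omega>. X j \<omega> * S J \<omega>)" "expectation (\<lambda>\<omega>. X j \<omega> * S J \<omega>) = 0"
      using indep_var_integrable[OF ind X1(1)[OF j(1)] IH(1)]
        indep_var_lebesgue_integral[OF ind X1(1)[OF j(1)] IH(1)] X1(2)[OF j(1)] by auto
    have sq: "(S (insert j J) \<omega>)\<^sup>2 = ((X j \<omega>)\<^sup>2 + (S J \<omega>)\<^sup>2) + 2 * (X j \<omega> * S J \<omega>)" for \<omega>
      using j by (simp add: power2_eq_square algebra_simps)
    show ?case
      unfolding sq using j X1[OF j(1)] IH prod by (auto simp: algebra_simps)
  qed simp
  then show "integrable M (S J)" "expectation (S J) = 0"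
    "integrable M (\<lambda>\<omega>. (S J \<omega>)\<^sup>2)" "expectation (\<lambda>\<omega>. (S J \<omega>)\<^sup>2) = real (card J) * v" by auto
qed

text \<open>Chebyshev's inequality; it supplies the probability one half demanded by
  \<open>first_occurrence_bound\<close>.\<close>

lemma prob_sum_ge_half:
  assumes "finite J" "J \<subseteq> I" "c > 0" "2 * real (card J) * v \<le> c\<^sup>2"
  shows "prob {\<omega>\<in>space M. - c \<le> S J \<omega>} \<ge> 1 / 2"
proof -
  note [measurable] = S_meas[OF assms(2)]
  note m = second_moment_sum[OF assms(1,2)]
  have "prob {\<omega>\<in>space M. \<bar>S J \<omega> - expectation (S J)\<bar> \<ge> c} \<le> variance (S J) / c\<^sup>2"
    using m(3) assms(3) by (intro Chebyshev_inequality) auto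
  also have "\<dots> = real (card J) * v / c\<^sup>2" using m by simp
  also have "\<dots> \<le> 1 / 2" using assms(3,4) by (simp add: field_simps)
  finally have "prob {\<omega>\<in>space M. \<bar>S J \<omega>\<bar> \<ge> c} \<le> 1 / 2" by (simp add: m(2))
  moreover have "prob {\<omega>\<in>space M. S J \<omega> < - c} \<le> prob {\<omega>\<in>space M. \<bar>S J \<omega>\<bar> \<ge> c}"
    by (intro finite_measure_mono) auto
  moreover have "prob {\<omega>\<in>space M. - c \<le> S J \<omega>} = 1 - prob {\<omega>\<in>space M. S J \<omega> < - c}"
    by (subst prob_compl[symmetric]) (auto intro!: arg_cong[where f=prob])
  ultimately show ?thesis by simp
qed

text \<open>The characteristic function of a sum is a power determined by the number of terms alone.
  A limit theorem proved along one enumeration thereby applies to every index set of the same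
  size.\<close>

lemma distr_sum_eq:
  assumes "J \<subseteq> I" "J' \<subseteq> I" "card J = card J'"
  shows "distr M borel (S J) = distr M borel (S J')"
proof (rule Levy_uniqueness)
  show "real_distribution (distr M borel (S J))" "real_distribution (distr M borel (S J'))"
    using assms by (auto intro!: real_distribution_distr S_meas)
  have *: "char (distr M borel (S K)) t = char (distr M borel X0) t ^ card K" if "K \<subseteq> I" for K t
  proof -
    have "char (distr M borel (S K)) t = (\<Prod>i\<in>K. char (distr M borel (X i)) t)"
      by (rule char_distr_sum[OF indep_vars_subset[OF indep that]])
    also have "\<dots> = (\<Prod>i\<in>K. char (distr M borel X0) t)"
      using that by (intro prod.cong) (auto simp: ident)
    finally show ?thesis by simp
  qed
  show "char (distr M borel (S J)) = char (distr M borel (S J'))"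
    using assms by (auto simp: fun_eq_iff *)
qed

lemma prob_sum_gt_eq:
  assumes "J \<subseteq> I" "J' \<subseteq> I" "card J = card J'"
  shows "prob {\<omega>\<in>space M. S J \<omega> > x} = prob {\<omega>\<in>space M. S J' \<omega> > x}"
proof -
  have *: "prob {\<omega>\<in>space M. S K \<omega> > x} = measure (distr M borel (S K)) {x<..}" if "K \<subseteq> I" for K
    using S_meas[OF that] by (subst measure_distr) (auto intro!: arg_cong[where f=prob])
  show ?thesis using assms by (simp add: * distr_sum_eq[OF assms])
qed

lemma prob_sum_gt_mult:
  assumes "A \<inter> B = {}" "A \<subseteq> I" "B \<subseteq> I" "finite A" "finite B"
  shows "prob {\<omega>\<in>space M. S A \<omega> > x} * prob {\<omega>\<in>space M. S B \<omega> > y}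
    \<le> prob {\<omega>\<in>space M. S (A \<union> B) \<omega> > x + y}"
proof -
  have "prob {\<omega>\<in>space M. S A \<omega> > x} * prob {\<omega>\<in>space M. S B \<omega> > y}
    = prob {\<omega>\<in>space M. (\<Sum>i\<in>A. (\<lambda>i\<in>A. X i \<omega>) i) > x \<and> (\<Sum>i\<in>B. (\<lambda>i\<in>B. X i \<omega>) i) > y}"
    using assms by (subst prob_indep_restrict[OF indep, where P="\<lambda>f. (\<Sum>i\<in>A. f i) > x" and Q="\<lambda>f. (\<Sum>i\<in>B. f i) > y"])
      (auto intro!: borel_measurable_pred_less borel_measurable_sum)
  also have "\<dots> \<le> prob {\<omega>\<in>space M. S (A \<union> B) \<omega> > x + y}"
    using assms S_meas[of "A \<union> B"]
    by (intro finite_measure_mono) (auto simp: sum.union_disjoint)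
  finally show ?thesis .
qed

text \<open>Chernoff bound after truncation from above at \<open>b\<close>. Setting values above
  \<open>b\<close> to 0 removes only positive mass, so the truncated mean is at most 0 and the
  second moment does not grow. The bounds \<open>V\<close> and \<open>s\<close> replace the exact
  cardinality and variance; \<open>s\<close> may be taken positive even when the variance is
  0.\<close>

lemma upper_tail:
  assumes J: "finite J" "J \<subseteq> I" and V: "real (card J) \<le> V" and "t \<ge> 0" "b \<ge> 0" and s: "v \<le> s"
  shows "prob {\<omega>\<in>space M. S J \<omega> > x}
    \<le> V * prob {\<omega>\<in>space M. X0 \<omega> > b} + exp (- t * x + V * (t\<^sup>2 * s * exp (t * b) / 2))"
proof -
  define h where "h y = (if y \<le> b then y else 0)" for y :: real
  have [measurable]: "h \<in> borel_measurable borel" unfolding h_def by measurable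
  note [measurable] = X_meas[OF subsetD[OF J(2)]]
  define E where "E = expectation (\<lambda>\<omega>. exp (t * h (X0 \<omega>)))"
  have int: "integrable M (\<lambda>\<omega>. exp (t * h (X0 \<omega>)))"
    using assms(4,5) by (intro integrable_const_bound[where B="exp (t * b)"]) (auto simp: h_def mult_left_mono)
  have inth: "integrable M (\<lambda>\<omega>. h (X0 \<omega>))"
    by (rule Bochner_Integration.integrable_bound[OF integrable_X0]) (auto simp: h_def)
  have inth2: "integrable M (\<lambda>\<omega>. (h (X0 \<omega>))\<^sup>2)"
    by (rule Bochner_Integration.integrable_bound[OF integrable_square_X0]) (auto simp: h_def)
  have mean: "expectation (\<lambda>\<omega>. h (X0 \<omega>)) \<le> 0"
    using integral_mono[OF inth integrable_X0] assms(5) mean_X0 by (simp add: h_def)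
  have sq: "expectation (\<lambda>\<omega>. (h (X0 \<omega>))\<^sup>2) \<le> s"
    using integral_mono[OF inth2 integrable_square_X0] s by (force simp: h_def v_def)
  have "E \<le> expectation (\<lambda>\<omega>. 1 + t * h (X0 \<omega>) + t\<^sup>2 * exp (t * b) / 2 * (h (X0 \<omega>))\<^sup>2)"
    unfolding E_def
  proof (intro integral_mono int)
    fix \<omega>
    have "max (t * h (X0 \<omega>)) 0 \<le> t * b" using assms(4,5) by (auto simp: h_def mult_left_mono)
    then have "(t * h (X0 \<omega>))\<^sup>2 / 2 * exp (max (t * h (X0 \<omega>)) 0) \<le> (t * h (X0 \<omega>))\<^sup>2 / 2 * exp (t * b)"
      by (intro mult_left_mono) auto
    then show "exp (t * h (X0 \<omega>)) \<le> 1 + t * h (X0 \<omega>) + t\<^sup>2 * exp (t * b) / 2 * (h (X0 \<omega>))\<^sup>2"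
      using exp_le_quadratic[of "t * h (X0 \<omega>)"] by (simp add: power_mult_distrib mult_ac)
  qed (use inth inth2 in auto)
  also have "\<dots> = 1 + t * expectation (\<lambda>\<omega>. h (X0 \<omega>)) + t\<^sup>2 * exp (t * b) / 2 * expectation (\<lambda>\<omega>. (h (X0 \<omega>))\<^sup>2)"
    using inth inth2 by (simp add: prob_space)
  also have "\<dots> \<le> 1 + t\<^sup>2 * exp (t * b) / 2 * s"
    using mult_nonneg_nonpos[OF assms(4) mean] mult_left_mono[OF sq, of "t\<^sup>2 * exp (t * b) / 2"] by simp
  also have "\<dots> \<le> exp (t\<^sup>2 * s * exp (t * b) / 2)"
    using exp_ge_add_one_self[of "t\<^sup>2 * s * exp (t * b) / 2"] by (simp add: mult_ac)
  finally have E: "E \<le> exp (t\<^sup>2 * s * exp (t * b) / 2)" .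
  have E0: "0 \<le> E" unfolding E_def by (simp add: integral_nonneg_AE)
  have s0: "0 \<le> s" using v_nonneg s by simp

  define Y where "Y j \<omega> = exp (t * h (X j \<omega>))" for j \<omega>
  have Yind: "indep_vars (\<lambda>_. borel) Y J"
    unfolding Y_def by (rule indep_vars_compose2[OF indep_vars_subset[OF indep J(2)]]) measurable
  have Y: "integrable M (Y j)" "expectation (Y j) = E" if "j \<in> J" for j
  proof -
    have j: "j \<in> I" using that J(2) by auto
    show "integrable M (Y j)" unfolding Y_def
      by (rule integrable_comp_iff[OF j, of "\<lambda>y. exp (t * h y)", THEN iffD2, OF _ int]) measurable
    show "expectation (Y j) = E" unfolding Y_def E_def
      by (rule expectation_comp[OF j, of "\<lambda>y. exp (t * h y)"]) measurable
  qed
  have prodY: "integrable M (\<lambda>\<omega>. \<Prod>j\<in>J. Y j \<omega>)" "expectation (\<lambda>\<omega>. \<Prod>j\<in>J. Y j \<omega>) = E ^ card J"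
    using indep_vars_integrable[OF J(1) Yind Y(1)] indep_vars_lebesgue_integral[OF J(1) Yind Y(1)] Y(2) by auto
  have Yexp: "(\<Prod>j\<in>J. Y j \<omega>) = exp (t * (\<Sum>j\<in>J. h (X j \<omega>)))" for \<omega>
    unfolding Y_def by (simp add: exp_sum[OF J(1), symmetric] sum_distrib_left)
  have "prob {\<omega>\<in>space M. (\<Sum>j\<in>J. h (X j \<omega>)) > x} \<le> prob {\<omega>\<in>space M. (\<Prod>j\<in>J. Y j \<omega>) \<ge> exp (t * x)}"
    using assms(4) by (intro finite_measure_mono) (auto simp: Yexp intro!: mult_left_mono)
  also have "\<dots> \<le> expectation (\<lambda>\<omega>. \<Prod>j\<in>J. Y j \<omega>) / exp (t * x)"
    by (rule integral_Markov_inequality_measure[OF prodY(1) sets.top]) (auto simp: Yexp)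
  also note prodY(2)
  also have "E ^ card J \<le> exp (V * (t\<^sup>2 * s * exp (t * b) / 2))"
  proof -
    have "E ^ card J \<le> exp (t\<^sup>2 * s * exp (t * b) / 2) ^ card J" using E E0 by (intro power_mono)
    also have "\<dots> = exp (real (card J) * (t\<^sup>2 * s * exp (t * b) / 2))" by (rule exp_of_nat_mult[symmetric])
    also have "\<dots> \<le> exp (V * (t\<^sup>2 * s * exp (t * b) / 2))"
      using V s0 by (auto intro!: mult_right_mono divide_right_mono)
    finally show ?thesis .
  qed
  finally have "prob {\<omega>\<in>space M. (\<Sum>j\<in>J. h (X j \<omega>)) > x}
    \<le> exp (V * (t\<^sup>2 * s * exp (t * b) / 2)) / exp (t * x)" by (simp add: divide_right_mono)
  also have "\<dots> = exp (- t * x + V * (t\<^sup>2 * s * exp (t * b) / 2))"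
    by (simp only: exp_diff[symmetric]) (simp add: algebra_simps)
  finally have 1: "prob {\<omega>\<in>space M. (\<Sum>j\<in>J. h (X j \<omega>)) > x} \<le> exp (- t * x + V * (t\<^sup>2 * s * exp (t * b) / 2))" .
  have 2: "prob (\<Union>j\<in>J. {\<omega>\<in>space M. X j \<omega> > b}) \<le> V * prob {\<omega>\<in>space M. X0 \<omega> > b}"
  proof -
    have "prob (\<Union>j\<in>J. {\<omega>\<in>space M. X j \<omega> > b}) \<le> (\<Sum>j\<in>J. prob {\<omega>\<in>space M. X j \<omega> > b})"
      using J(1) by (intro finite_measure_subadditive_finite) auto
    also have "\<dots> = real (card J) * prob {\<omega>\<in>space M. X0 \<omega> > b}"
      using J(2) prob_comp[where P="\<lambda>y. y > b"] by (simp add: subset_eq)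
    also have "\<dots> \<le> V * prob {\<omega>\<in>space M. X0 \<omega> > b}" using V by (intro mult_right_mono) auto
    finally show ?thesis .
  qed
  have [measurable]: "(\<Union>j\<in>J. {\<omega>\<in>space M. X j \<omega> > b}) \<in> events"
    using J(1) by (intro sets.finite_UN) auto
  have "prob {\<omega>\<in>space M. S J \<omega> > x}
    \<le> prob ((\<Union>j\<in>J. {\<omega>\<in>space M. X j \<omega> > b}) \<union> {\<omega>\<in>space M. (\<Sum>j\<in>J. h (X j \<omega>)) > x})"
  proof (intro finite_measure_mono subsetI)
    fix \<omega> assume w: "\<omega> \<in> {\<omega>\<in>space M. S J \<omega> > x}"
    show "\<omega> \<in> (\<Union>j\<in>J. {\<omega>\<in>space M. X j \<omega> > b}) \<union> {\<omega>\<in>space M. (\<Sum>j\<in>J. h (X j \<omega>)) > x}"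
    proof (cases "\<exists>j\<in>J. X j \<omega> > b")
      case False
      then have "(\<Sum>j\<in>J. h (X j \<omega>)) = S J \<omega>" by (intro sum.cong) (auto simp: h_def)
      then show ?thesis using w by auto
    qed (use w in auto)
  qed measurable
  also have "\<dots> \<le> prob (\<Union>j\<in>J. {\<omega>\<in>space M. X j \<omega> > b}) + prob {\<omega>\<in>space M. (\<Sum>j\<in>J. h (X j \<omega>)) > x}"
    by (intro measure_Un_le) measurable
  finally show ?thesis using 1 2 by simp
qed

end

section \<open>Lower tail bound\<close>

text \<open>Between \<open>z\<close> and \<open>z + 1\<close> the density is at least its value at
  \<open>z + 1\<close>, and this interval alone already has the right exponential order.\<close>

lemma std_normal_tail_ge:
  assumes "z \<ge> 0"
  shows "measure std_normal_distribution {z<..} \<ge> exp (- (z + 1)\<^sup>2 / 2) / sqrt (2 * pi)"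
proof -
  interpret N: real_distribution std_normal_distribution by (rule real_dist_normal_dist)
  define c where "c = exp (- (z + 1)\<^sup>2 / 2) / sqrt (2 * pi)"
  have c: "c \<ge> 0" by (simp add: c_def)
  have "ennreal c = (\<integral>\<^sup>+x. ennreal c * indicator {z<..z+1} x \<partial>lborel)"
    by (simp add: nn_integral_cmult_indicator)
  also have "\<dots> \<le> (\<integral>\<^sup>+x. ennreal (std_normal_density x) * indicator {z<..} x \<partial>lborel)"
  proof (intro nn_integral_mono)
    fix x :: real
    show "ennreal c * indicator {z<..z+1} x \<le> ennreal (std_normal_density x) * indicator {z<..} x"
    proof (cases "x \<in> {z<..z+1}")
      case True
      then have "x\<^sup>2 \<le> (z + 1)\<^sup>2" using assms by (intro power_mono) auto
      then have "c \<le> std_normal_density x"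
        unfolding c_def std_normal_density_def by (simp add: divide_right_mono)
      then show ?thesis using True by (simp add: ennreal_leI)
    qed simp
  qed
  also have "\<dots> = emeasure std_normal_distribution {z<..}"
    by (subst emeasure_density) auto
  finally show ?thesis unfolding c_def[symmetric] using c by (simp add: N.emeasure_eq_measure)
qed

context iid_family
begin

text \<open>The central limit theorem becomes uniform over index sets: \<open>m0\<close> works for
  every \<open>J\<close> of at least that size, because the law of the sum sees only the
  cardinality.\<close>

lemma clt_tail:
  assumes "infinite I" "v > 0" "p < measure std_normal_distribution {z<..}"
  obtains m0 where "\<And>J. finite J \<Longrightarrow> J \<subseteq> I \<Longrightarrow> m0 \<le> card J \<Longrightarrow>
    p \<le> prob {\<omega>\<in>space M. S J \<omega> > z * sqrt (real (card J) * v)}"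
proof -
  interpret N: real_distribution std_normal_distribution by (rule real_dist_normal_dist)
  obtain e :: "nat \<Rightarrow> 'i" where e: "inj e" "range e \<subseteq> I"
    using infinite_countable_subset[OF assms(1)] by blast
  define Y where "Y i = X (e i)" for i
  have eI: "e i \<in> I" for i using e by auto
  have Yind: "indep_vars (\<lambda>_. borel) Y UNIV"
  proof -
    have "indep_vars (\<lambda>j. PiM {e j} (\<lambda>_. borel)) (\<lambda>j \<omega>. \<lambda>i\<in>{e j}. X i \<omega>) UNIV"
      using e by (intro indep_vars_restrict[OF indep]) (auto simp: disjoint_family_on_def inj_eq)
    from indep_vars_compose2[OF this, of "\<lambda>j f. f (e j)" "\<lambda>_. borel"] show ?thesis
      by (simp add: Y_def[abs_def])
  qed
  define \<mu>n where "\<mu>n n = distr M borel (\<lambda>x. (\<Sum>i<n. Y i x) / sqrt (real n * (sqrt v)\<^sup>2))" for n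
  have "weak_conv_m \<mu>n std_normal_distribution"
    unfolding \<mu>n_def
  proof (rule central_limit_theorem_zero_mean[OF Yind])
    fix n
    show m0: "expectation (Y n) = 0" unfolding Y_def using expectation_comp[OF eI, of "\<lambda>x. x"] mean_X0 by simp
    show "integrable M (\<lambda>x. (Y n x)\<^sup>2)"
      unfolding Y_def using integrable_comp_iff[OF eI, of "\<lambda>x. x\<^sup>2"] integrable_square_X0 by simp
    have "expectation (\<lambda>x. (Y n x)\<^sup>2) = v" unfolding Y_def using expectation_comp[OF eI, of "\<lambda>x. x\<^sup>2"] by (simp add: v_def)
    then show "variance (Y n) = (sqrt v)\<^sup>2" using m0 assms(2) by simp
    show "distr M borel (Y n) = distr M borel X0" unfolding Y_def by (rule ident[OF eI])
  qed (use assms in auto)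
  \<comment> \<open>Weak convergence gives convergence of the distribution function at continuity
    points only.\<close>
  moreover have "isCont (cdf std_normal_distribution) z"
  proof -
    have "emeasure std_normal_distribution {z} = (\<integral>\<^sup>+x. ennreal (std_normal_density x) * indicator {z} x \<partial>lborel)"
      by (subst emeasure_density) auto
    also have "\<dots> = 0"
      using AE_lborel_singleton[of z] by (subst nn_integral_0_iff_AE) (auto simp: indicator_def)
    finally show ?thesis unfolding N.isCont_cdf by (simp add: measure_def)
  qed
  ultimately have lim: "(\<lambda>n. cdf (\<mu>n n) z) \<longlonglongrightarrow> cdf std_normal_distribution z"
    by (auto simp: weak_conv_m_def weak_conv_def)
  have "measure std_normal_distribution {z<..} = 1 - cdf std_normal_distribution z"
    unfolding cdf_def by (subst N.prob_compl[symmetric]) (auto intro!: arg_cong[where f="measure _"])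
  then have "cdf std_normal_distribution z < 1 - p" using assms(3) by simp
  from order_tendstoD(2)[OF lim this] obtain m1 where m1: "\<And>n. n \<ge> m1 \<Longrightarrow> cdf (\<mu>n n) z < 1 - p"
    by (auto simp: eventually_sequentially)
  have "p \<le> prob {\<omega>\<in>space M. S J \<omega> > z * sqrt (real (card J) * v)}"
    if J: "finite J" "J \<subseteq> I" "max m1 1 \<le> card J" for J
  proof -
    define n where "n = card J"
    have n: "n \<ge> m1" "n > 0" using J(3) by (auto simp: n_def)
    have SY: "(\<Sum>i<n. Y i \<omega>) = S (e ` {..<n}) \<omega>" for \<omega>
      unfolding Y_def by (subst sum.reindex) (use e(1) in \<open>auto intro: inj_on_subset\<close>)
    have sub: "e ` {..<n} \<subseteq> I" using e by auto
    have cardeq: "card (e ` {..<n}) = card J"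
      using e(1) by (subst card_image) (auto simp: n_def intro: inj_on_subset)
    have meas[measurable]: "(\<lambda>\<omega>. \<Sum>i<n. Y i \<omega>) \<in> borel_measurable M" unfolding SY by (rule S_meas[OF sub])
    have pos: "sqrt (real n * v) > 0" using n assms(2) by simp
    have "cdf (\<mu>n n) z = prob {\<omega>\<in>space M. (\<Sum>i<n. Y i \<omega>) / sqrt (real n * v) \<le> z}"
      unfolding \<mu>n_def cdf_def using assms(2) by (subst measure_distr) (auto intro!: arg_cong[where f=prob])
    also have "\<dots> = 1 - prob {\<omega>\<in>space M. (\<Sum>i<n. Y i \<omega>) / sqrt (real n * v) > z}"
      by (subst prob_compl[symmetric]) (auto intro!: arg_cong[where f=prob])
    also have "{\<omega>\<in>space M. (\<Sum>i<n. Y i \<omega>) / sqrt (real n * v) > z} = {\<omega>\<in>space M. S (e ` {..<n}) \<omega> > z * sqrt (real n * v)}"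
      using pos by (simp add: SY pos_less_divide_eq)
    also have "prob \<dots> = prob {\<omega>\<in>space M. S J \<omega> > z * sqrt (real n * v)}"
      by (rule prob_sum_gt_eq[OF sub J(2) cardeq])
    finally show ?thesis using m1[OF n(1)] by (simp add: n_def)
  qed
  then show ?thesis using that by blast
qed

text \<open>Disjoint pieces exceed their levels independently, which gives the product
  \<open>p ^ k\<close>. All pieces but one have exactly \<open>m\<close> elements; the base case
  takes whatever is left over.\<close>

lemma block_tail:
  assumes "z > 0" "p \<ge> 0"
    and base: "\<And>J. finite J \<Longrightarrow> J \<subseteq> I \<Longrightarrow> m0 \<le> card J \<Longrightarrow>
      p \<le> prob {\<omega>\<in>space M. S J \<omega> > z * sqrt (real (card J) * v)}"
    and "m0 \<le> m" "finite J" "J \<subseteq> I" "k * m \<le> card J" "k \<ge> 1"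
  shows "p ^ k \<le> prob {\<omega>\<in>space M. S J \<omega> > real k * (z * sqrt (real m * v))}"
  using assms(8,5,6,7)
proof (induction k arbitrary: J rule: dec_induct)
  case base
  then have "p \<le> prob {\<omega>\<in>space M. S J \<omega> > z * sqrt (real (card J) * v)}"
    using assms(3)[of J] assms(4) by simp
  also have "\<dots> \<le> prob {\<omega>\<in>space M. S J \<omega> > z * sqrt (real m * v)}"
  proof -
    have "z * sqrt (real m * v) \<le> z * sqrt (real (card J) * v)"
      using base assms(1) v_nonneg by (intro mult_left_mono real_sqrt_le_mono mult_right_mono) auto
    then show ?thesis using S_meas[OF base(2)] by (intro finite_measure_mono) auto
  qed
  finally show ?case by simp
next
  case (step k)
  obtain A where A: "A \<subseteq> J" "card A = m"
    using obtain_subset_with_card_n[of m J] step.prems by auto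
  have fin: "finite A" "finite (J - A)" using A step.prems by (auto intro: finite_subset)
  have cB: "card (J - A) = card J - m" using A fin by (simp add: card_Diff_subset)
  have "p ^ Suc k \<le> prob {\<omega>\<in>space M. S A \<omega> > z * sqrt (real m * v)} * prob {\<omega>\<in>space M. S (J - A) \<omega> > real k * (z * sqrt (real m * v))}"
    unfolding power_Suc
  proof (intro mult_mono)
    show "p \<le> prob {\<omega>\<in>space M. S A \<omega> > z * sqrt (real m * v)}"
      using base[of A] A fin step.prems assms(4) by auto
    have "k * m \<le> card (J - A)" using cB step.prems(3) by simp
    then show "p ^ k \<le> prob {\<omega>\<in>space M. S (J - A) \<omega> > real k * (z * sqrt (real m * v))}"
      using step.IH[of "J - A"] step.prems by auto
  qed (use assms(2) in auto)
  also have "\<dots> \<le> prob {\<omega>\<in>space M. S (A \<union> (J - A)) \<omega> > z * sqrt (real m * v) + real k * (z * sqrt (real m * v))}"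
    using A fin step.prems by (intro prob_sum_gt_mult) auto
  also have "A \<union> (J - A) = J" using A by auto
  finally show ?case by (simp add: algebra_simps)
qed

text \<open>Cut \<open>J\<close> into about \<open>k = 2 * \<theta> * L / z\<^sup>2\<close> pieces
  of size \<open>N / k\<close>. If each exceeds \<open>z\<close> standard deviations, the sum
  exceeds \<open>z * sqrt (k * N * v)\<close>, which is the required level. The cost is about
  \<open>exp (- z\<^sup>2 / 2)\<close> per piece, hence \<open>exp (- \<theta> * L)\<close> in all.
  The factor \<open>1 + \<eta>\<close> pays for the Gaussian tail estimate and for incomplete
  covering.\<close>

lemma lower_tail:
  assumes "infinite I" "v > 0" "\<theta> > 0" "\<eta> > 0"
  obtains C \<kappa> N0 where "C > 0" "\<kappa> > 0"
    "\<And>J L. finite J \<Longrightarrow> J \<subseteq> I \<Longrightarrow> N0 \<le> card J \<Longrightarrow> 0 \<le> L \<Longrightarrow> L \<le> \<kappa> * real (card J) \<Longrightarrow>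
      C * exp (- (1 + \<eta>) * \<theta> * L) \<le> prob {\<omega>\<in>space M. S J \<omega> > sqrt (2 * \<theta> * v * real (card J) * L)}"
proof -
  define \<eta>1 where "\<eta>1 = \<eta> / 2"
  \<comment> \<open>The loss \<open>1 + \<eta>\<close> is split: \<open>1 + \<eta>1\<close> goes
    into the Gaussian tail, and \<rho> is the fraction of \<open>J\<close> that the \<open>k\<close>
    pieces must cover.\<close>
  define \<rho> where "\<rho> = (1 + \<eta>1) / (1 + \<eta>)"
  have \<rho>: "0 < \<rho>" "\<rho> < 1" using assms by (auto simp: \<rho>_def \<eta>1_def field_simps)
  define c where "c = ln (sqrt (2 * pi))"
  have "\<eta>1 > 0" using assms by (simp add: \<eta>1_def)
  \<comment> \<open>For a fixed large \<open>z\<close> the gain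
    \<open>\<eta>1 * z\<^sup>2 / 2\<close> in the exponent beats the cross term and the prefactor of
    the Gaussian bound.\<close>
  then have "eventually (\<lambda>z::real. \<eta>1 * z\<^sup>2 / 2 - z - 1 / 2 - c > 0) at_top" by real_asymp
  then have "eventually (\<lambda>z::real. exp (- (1 + \<eta>1) * z\<^sup>2 / 2) < exp (- (z + 1)\<^sup>2 / 2) / sqrt (2 * pi)) at_top"
  proof eventually_elim
    case (elim z)
    have "exp (- (z + 1)\<^sup>2 / 2) / sqrt (2 * pi) = exp (- (z + 1)\<^sup>2 / 2 - c)"
      unfolding c_def by (simp add: exp_diff)
    moreover have "- (1 + \<eta>1) * z\<^sup>2 / 2 = - z\<^sup>2 / 2 - \<eta>1 * z\<^sup>2 / 2" by (simp add: field_simps)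
    moreover have "- (z + 1)\<^sup>2 / 2 = - z\<^sup>2 / 2 - z - 1 / 2" by (simp add: power2_eq_square field_simps)
    ultimately show ?case using elim by simp
  qed
  then have "eventually (\<lambda>z::real. z > 0 \<and> exp (- (1 + \<eta>1) * z\<^sup>2 / 2) < exp (- (z + 1)\<^sup>2 / 2) / sqrt (2 * pi)) at_top"
    using eventually_gt_at_top[of 0] by eventually_elim auto
  then obtain z where z: "z > 0" "exp (- (1 + \<eta>1) * z\<^sup>2 / 2) < exp (- (z + 1)\<^sup>2 / 2) / sqrt (2 * pi)"
    by (auto simp: eventually_at_top_linorder)
  define p where "p = exp (- (1 + \<eta>1) * z\<^sup>2 / 2)"
  have "p < measure std_normal_distribution {z<..}"
    using z std_normal_tail_ge[of z] by (simp add: p_def)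
  from clt_tail[OF assms(1,2) this] obtain m0 where m0: "\<And>J. finite J \<Longrightarrow> J \<subseteq> I \<Longrightarrow> m0 \<le> card J \<Longrightarrow>
      p \<le> prob {\<omega>\<in>space M. S J \<omega> > z * sqrt (real (card J) * v)}" by blast
  \<comment> \<open>With \<open>k \<le> \<epsilon> * N\<close> the pieces have at least
    \<open>m0\<close> elements, and rounding in \<open>N div k\<close> leaves at most
    \<open>(1 - \<rho>) * N\<close> elements uncovered.\<close>
  define \<epsilon> where "\<epsilon> = min (1 - \<rho>) (1 / (real m0 + 1))"
  have \<epsilon>: "\<epsilon> > 0" using \<rho> by (simp add: \<epsilon>_def)
  define \<kappa> where "\<kappa> = \<epsilon> * (z\<^sup>2 * \<rho>) / (4 * \<theta>)"
  have \<kappa>: "\<kappa> > 0" using \<epsilon> z \<rho> assms by (simp add: \<kappa>_def)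
  define N0 where "N0 = nat \<lceil>4 / \<epsilon>\<rceil>"
  \<comment> \<open>Rounding makes \<open>k\<close> exceed \<open>w\<close> by at most 2; this is
    the price \<open>p ^ 2\<close> of two more pieces.\<close>
  define C where "C = exp (- (1 + \<eta>1) * z\<^sup>2)"
  have "C * exp (- (1 + \<eta>) * \<theta> * L) \<le> prob {\<omega>\<in>space M. S J \<omega> > sqrt (2 * \<theta> * v * real (card J) * L)}"
    if J: "finite J" "J \<subseteq> I" "N0 \<le> card J" and L: "0 \<le> L" "L \<le> \<kappa> * real (card J)" for J L
  proof -
    define N where "N = card J"
    define w where "w = 2 * \<theta> * L / (z\<^sup>2 * \<rho>)"
    have w: "w \<ge> 0" using L \<rho> assms by (simp add: w_def)
    define k where "k = nat \<lceil>w\<rceil> + 1"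
    have k: "k \<ge> 1" "w \<le> real k" "real k \<le> w + 2" using w by (auto simp: k_def) linarith+
    have "4 / \<epsilon> \<le> real N" using J(3) unfolding N0_def N_def by linarith
    then have N: "4 \<le> \<epsilon> * real N" using \<epsilon> by (simp add: field_simps)
    have "w \<le> 2 * \<theta> * (\<kappa> * real N) / (z\<^sup>2 * \<rho>)"
      unfolding w_def N_def using L(2) assms z \<rho> by (intro divide_right_mono mult_left_mono) auto
    also have "\<dots> = \<epsilon> * real N / 2" using assms z \<rho> by (simp add: \<kappa>_def)
    finally have kN: "real k \<le> \<epsilon> * real N" using k N by simp
    define m where "m = N div k"
    have "real k \<le> real N / (real m0 + 1)"
      using kN mult_right_mono[of \<epsilon> "1 / (real m0 + 1)" "real N"] by (simp add: \<epsilon>_def)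
    then have "real (m0 * k) \<le> real N" by (simp add: field_simps)
    then have mm0: "m0 \<le> m" unfolding m_def using k(1)
      by (metis of_nat_le_iff less_eq_div_iff_mult_less_eq less_le_trans zero_less_one)
    have km: "k * m \<le> card J" unfolding m_def N_def by simp
    have "real N < real k * real m + real k"
      using k(1) dividend_less_times_div[of k N] by (metis One_nat_def Suc_le_lessD m_def of_nat_add of_nat_less_iff of_nat_mult add.commute)
    moreover have "real k \<le> (1 - \<rho>) * real N"
      using kN mult_right_mono[of \<epsilon> "1 - \<rho>" "real N"] by (simp add: \<epsilon>_def)
    ultimately have kmN: "\<rho> * real N \<le> real k * real m" by (simp add: algebra_simps)
    have "2 * \<theta> * v * real N * L = w * z\<^sup>2 * v * (\<rho> * real N)"
      using z \<rho> by (simp add: w_def)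
    also have "\<dots> \<le> real k * z\<^sup>2 * v * (real k * real m)"
    proof (rule mult_mono[OF _ kmN])
      show "w * z\<^sup>2 * v \<le> real k * z\<^sup>2 * v" using k(2) assms(2) by (intro mult_right_mono) auto
    qed (use \<rho> assms(2) in auto)
    also have "\<dots> = (real k * (z * sqrt (real m * v)))\<^sup>2"
      using assms(2) by (simp add: power_mult_distrib power2_eq_square algebra_simps)
    finally have le: "sqrt (2 * \<theta> * v * real N * L) \<le> real k * (z * sqrt (real m * v))"
      using z assms(2) by (intro real_le_lsqrt) auto
    have "C * exp (- (1 + \<eta>) * \<theta> * L) = exp (- ((1 + \<eta>1) * z\<^sup>2 / 2) * (w + 2))"
    proof -
      have "(1 + \<eta>1) * z\<^sup>2 / 2 * w = (1 + \<eta>1) / \<rho> * (\<theta> * L)"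
        using z \<rho> by (simp add: w_def)
      also have "(1 + \<eta>1) / \<rho> = 1 + \<eta>" using assms(4) by (simp add: \<rho>_def \<eta>1_def)
      finally show ?thesis unfolding C_def exp_add[symmetric] by (simp add: algebra_simps)
    qed
    also have "\<dots> \<le> exp (- ((1 + \<eta>1) * z\<^sup>2 / 2) * real k)"
    proof -
      have "(1 + \<eta>1) * z\<^sup>2 / 2 * real k \<le> (1 + \<eta>1) * z\<^sup>2 / 2 * (w + 2)"
        using k(3) assms(4) by (intro mult_left_mono) (auto simp: \<eta>1_def)
      then show ?thesis by simp
    qed
    also have "\<dots> = p ^ k" unfolding p_def by (simp add: exp_of_nat_mult[symmetric] algebra_simps)
    also have "\<dots> \<le> prob {\<omega>\<in>space M. S J \<omega> > real k * (z * sqrt (real m * v))}"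
      by (rule block_tail[OF z(1) _ m0 mm0 J(1,2) km k(1)]) (auto simp: p_def)
    also have "\<dots> \<le> prob {\<omega>\<in>space M. S J \<omega> > sqrt (2 * \<theta> * v * real N * L)}"
      using le S_meas[OF J(2)] by (intro finite_measure_mono) auto
    finally show ?thesis by (simp add: N_def)
  qed
  moreover have "C > 0" by (simp add: C_def)
  ultimately show ?thesis using that \<kappa> by blast
qed

end

section \<open>Maximal inequality for rectangular sums\<close>

definition block :: "('d::finite \<Rightarrow> nat) \<Rightarrow> ('d \<Rightarrow> nat) \<Rightarrow> ('d \<Rightarrow> nat) set" where
  "block n k = {j. \<forall>i. n i < j i \<and> j i \<le> n i + k i}"

lemma block_eq_PiE: "block n k = PiE UNIV (\<lambda>i. {n i<..n i + k i})"
  by (auto simp: block_def PiE_def Pi_def)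

lemma finite_block [simp, intro]: "finite (block n k)"
  unfolding block_eq_PiE by (intro finite_PiE) auto

lemma card_block: "card (block n k) = absn k"
  unfolding block_eq_PiE absn_def by (subst card_PiE) auto

lemma block_subset_pos_idx: "block n k \<subseteq> pos_idx"
  by (auto simp: block_def pos_idx_def) (metis bot_nat_0.extremum_strict neq0_conv)

lemma block_mono: "k \<le> N \<Longrightarrow> block n k \<subseteq> block n N"
  by (auto simp: block_def le_fun_def) (meson add_left_mono order_trans)

lemma finite_le_fun [simp]: "finite {k::'d::finite \<Rightarrow> nat. k \<le> N}"
proof -
  have "{k. k \<le> N} = PiE UNIV (\<lambda>i. {..N i})" by (auto simp: PiE_def Pi_def le_fun_def)
  then show ?thesis by (simp add: finite_PiE)
qed

locale iid_field = iid_family M X pos_idx X0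
  for M :: "'w measure" and X :: "('d::finite \<Rightarrow> nat) \<Rightarrow> 'w \<Rightarrow> real" and X0 :: "'w \<Rightarrow> real"
begin

lemma Tsum_eq: "Tsum X n k \<omega> = S (block n k) \<omega>"
  by (simp add: Tsum_def block_def)

lemma Tsum_meas [measurable]: "Tsum X n k \<in> borel_measurable M"
  using S_meas[OF block_subset_pos_idx] by (subst Tsum_eq[abs_def])

text \<open>These families interpolate between \<open>{N}\<close>, for empty \<open>A\<close>, and
  the whole box, for \<open>A = UNIV\<close>, so that one coordinate can be freed at a time.\<close>

definition slab :: "('d \<Rightarrow> nat) \<Rightarrow> 'd set \<Rightarrow> ('d \<Rightarrow> nat) set" where
  "slab N A = {k. k \<le> N \<and> (\<forall>i. i \<notin> A \<longrightarrow> k i = N i)}"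

lemma finite_slab: "finite (slab N A)"
  by (rule finite_subset[OF _ finite_le_fun[of N]]) (auto simp: slab_def)

text \<open>Pairs \<open>(t, k)\<close> are visited with the value \<open>t\<close> of coordinate
  \<open>a\<close> as leading rank, so a first excess at \<open>(t, k)\<close> is decided by the
  layer \<open>A1\<close>, where coordinate \<open>a\<close> is at most \<open>n a + t\<close>.
  Filling coordinate \<open>a\<close> up to \<open>N a\<close> adds a sum over sites
  \<open>A2\<close> beyond that layer, which is independent of the past and at least
  \<open>- c\<close> with probability at least one half.\<close>

lemma max_inequality_step:
  assumes "a \<notin> A" "c > 0" "2 * real (absn N) * v \<le> c\<^sup>2"
  shows "prob (\<Union>k\<in>slab N (insert a A). {\<omega>\<in>space M. Tsum X n k \<omega> > y + c})
    \<le> 2 * prob (\<Union>k\<in>slab N A. {\<omega>\<in>space M. Tsum X n k \<omega> > y})"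
proof -
  define R where "R = slab N A"
  have fR: "finite R" unfolding R_def by (rule finite_slab)
  define P where "P = {..N a} \<times> R"
  have fP: "finite P" using fR by (simp add: P_def)
  obtain idx where idx: "bij_betw idx R {0..<card R}" using ex_bij_betw_finite_nat[OF fR] by blast
  \<comment> \<open>Lexicographic rank. Ties in \<open>t\<close> are broken arbitrarily, which is
    harmless since equal \<open>t\<close> involves the same layer.\<close>
  define r where "r p = fst p * card R + idx (snd p)" for p
  have idx_lt: "idx k < card R" if "k \<in> R" for k using idx that by (auto simp: bij_betw_def)
  have r_le: "fst p' \<le> fst p" if "p \<in> P" "p' \<in> P" "r p' \<le> r p" for p p'
  proof (rule ccontr)
    assume "\<not> fst p' \<le> fst p"
    then have "Suc (fst p) * card R \<le> fst p' * card R" by (intro mult_right_mono) auto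
    moreover have "idx (snd p) < card R" using that by (intro idx_lt) (auto simp: P_def)
    ultimately show False using that(3) by (simp add: r_def)
  qed
  have inj: "inj_on r P"
  proof (rule inj_onI)
    fix p p' assume p: "p \<in> P" "p' \<in> P" "r p = r p'"
    then have fst: "fst p = fst p'" using r_le[of p p'] r_le[of p' p] by simp
    from this p have "idx (snd p) = idx (snd p')" by (simp add: r_def)
    moreover have "snd p \<in> R" "snd p' \<in> R" using p by (auto simp: P_def)
    ultimately have "snd p = snd p'" using inj_onD[OF bij_betw_imp_inj_on[OF idx]] by blast
    then show "p = p'" using fst by (simp add: prod_eq_iff)
  qed
  define kk where "kk p = (snd p)(a := fst p)" for p :: "nat \<times> ('d \<Rightarrow> nat)"
  define G where "G p = {\<omega>\<in>space M. Tsum X n (kk p) \<omega> > y + c}" for p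
  define H where "H p = {\<omega>\<in>space M. Tsum X n (snd p) \<omega> - Tsum X n (kk p) \<omega> \<ge> - c}" for p
  have "prob (\<Union>p\<in>P. G p) \<le> 2 * prob (\<Union>p\<in>P. G p \<inter> H p)"
  proof (rule first_occurrence_bound[OF fP inj])
    fix p assume pP: "p \<in> P"
    obtain t k where p: "p = (t, k)" by (cases p)
    have tk: "t \<le> N a" "k \<in> R" "k a = N a" "k \<le> N" using pP assms(1) by (auto simp: p P_def R_def slab_def)
    define P' where "P' = {p'\<in>P. r p' < r p}"
    have fP': "finite P'" using fP by (simp add: P'_def)
    define A1 where "A1 = {j \<in> block n N. j a \<le> n a + t}"
    define A2 where "A2 = {j \<in> block n k. n a + t < j a}"
    have sub1: "block n (kk p') \<subseteq> A1" if "p' \<in> P" "fst p' \<le> t" for p'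
    proof
      fix j assume j: "j \<in> block n (kk p')"
      have "snd p' \<le> N" "fst p' \<le> N a" using that by (auto simp: P_def R_def slab_def)
      then have "kk p' \<le> N" by (auto simp: kk_def le_fun_def)
      then have "j \<in> block n N" using j block_mono by blast
      moreover have "j a \<le> n a + fst p'" using j by (auto simp: block_def kk_def dest: spec[of _ a])
      ultimately show "j \<in> A1" using that by (simp add: A1_def)
    qed
    have sub1': "block n (kk p') \<subseteq> A1" if "p' \<in> P'" for p'
      using that r_le[OF pP, of p'] p by (intro sub1) (auto simp: P'_def)
    have sub1p: "block n (kk p) \<subseteq> A1" using pP p by (intro sub1) auto
    have fA: "finite A2" by (simp add: A2_def)
    define P0 where "P0 f \<longleftrightarrow> (\<Sum>j\<in>block n (kk p). f j) > y + c \<and> (\<forall>p'\<in>P'. \<not> (\<Sum>j\<in>block n (kk p'). f j) > y + c)"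
      for f :: "('d \<Rightarrow> nat) \<Rightarrow> real"
    define Q0 where "Q0 f \<longleftrightarrow> (\<Sum>j\<in>A2. f j) \<ge> - c" for f :: "('d \<Rightarrow> nat) \<Rightarrow> real"
    have dec: "Tsum X n k \<omega> - Tsum X n (kk p) \<omega> = S A2 \<omega>" for \<omega>
    proof -
      have e: "block n (kk p) = {j \<in> block n k. j a \<le> n a + t}"
      proof (intro set_eqI iffI)
        fix j assume j: "j \<in> block n (kk p)"
        have "kk p \<le> k" using tk by (auto simp: le_fun_def kk_def p)
        then have "j \<in> block n k" using j block_mono by blast
        moreover have "j a \<le> n a + t" using j by (auto simp: block_def kk_def p dest: spec[of _ a])
        ultimately show "j \<in> {j \<in> block n k. j a \<le> n a + t}" by simp
      next
        fix j assume "j \<in> {j \<in> block n k. j a \<le> n a + t}"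
        then show "j \<in> block n (kk p)" by (simp add: block_def kk_def p)
      qed
      have "block n k = block n (kk p) \<union> A2" unfolding e A2_def by auto
      moreover have "block n (kk p) \<inter> A2 = {}" unfolding e A2_def by auto
      ultimately have "S (block n k) \<omega> = S (block n (kk p)) \<omega> + S A2 \<omega>"
        using sum.union_disjoint[OF finite_block fA, of n "kk p" "\<lambda>j. X j \<omega>"] by simp
      then show ?thesis by (simp add: Tsum_eq)
    qed
    have D: "G p - (\<Union>p'\<in>P'. G p') = {\<omega>\<in>space M. P0 (\<lambda>i\<in>A1. X i \<omega>)}"
    proof -
      have "(\<Sum>j\<in>block n (kk p'). (\<lambda>i\<in>A1. X i \<omega>) j) = Tsum X n (kk p') \<omega>" if "block n (kk p') \<subseteq> A1" for p' \<omega>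
        unfolding Tsum_eq using that by (intro sum.cong) auto
      then show ?thesis using sub1' sub1p by (auto simp: P0_def G_def)
    qed
    have HQ: "H p = {\<omega>\<in>space M. Q0 (\<lambda>i\<in>A2. X i \<omega>)}"
      using dec by (simp add: H_def p Q0_def)
    have meas0: "(\<lambda>f. \<Sum>j\<in>B. f j) \<in> borel_measurable (PiM A' (\<lambda>_. borel :: real measure))"
      if "B \<subseteq> A'" for A' B :: "('d \<Rightarrow> nat) set"
      using that by (intro borel_measurable_sum measurable_component_singleton) auto
    have "Measurable.pred (PiM A1 (\<lambda>_. borel)) P0"
      unfolding P0_def using meas0[OF sub1'] meas0[OF sub1p] fP'
      by (intro pred_intros_logic pred_intros_finite borel_measurable_pred_less) auto
    moreover have "Measurable.pred (PiM A2 (\<lambda>_. borel)) Q0"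
    proof -
      note [measurable] = meas0[OF order_refl, of A2]
      show ?thesis unfolding Q0_def by measurable
    qed
    moreover have "A1 \<inter> A2 = {}" by (auto simp: A1_def A2_def)
    moreover have "A1 \<subseteq> pos_idx" "A2 \<subseteq> pos_idx"
      using block_subset_pos_idx by (auto simp: A1_def A2_def)
    ultimately have "prob {\<omega>\<in>space M. P0 (\<lambda>i\<in>A1. X i \<omega>) \<and> Q0 (\<lambda>i\<in>A2. X i \<omega>)}
      = prob {\<omega>\<in>space M. P0 (\<lambda>i\<in>A1. X i \<omega>)} * prob {\<omega>\<in>space M. Q0 (\<lambda>i\<in>A2. X i \<omega>)}"
      by (intro prob_indep_restrict[OF indep]) auto
    also have "{\<omega>\<in>space M. P0 (\<lambda>i\<in>A1. X i \<omega>) \<and> Q0 (\<lambda>i\<in>A2. X i \<omega>)} = (G p - (\<Union>p'\<in>P'. G p')) \<inter> H p"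
      unfolding D HQ by auto
    finally have eq: "prob ((G p - (\<Union>p'\<in>P'. G p')) \<inter> H p) = prob (G p - (\<Union>p'\<in>P'. G p')) * prob (H p)"
      unfolding D HQ .
    have "prob (H p) \<ge> 1 / 2"
    proof -
      have "card A2 \<le> card (block n N)" using block_mono[OF tk(4), of n] by (intro card_mono) (auto simp: A2_def)
      then have "real (card A2) \<le> real (absn N)" by (simp add: card_block)
      then have "2 * real (card A2) * v \<le> 2 * real (absn N) * v"
        using v_nonneg by (intro mult_right_mono) auto
      then have "prob {\<omega>\<in>space M. - c \<le> S A2 \<omega>} \<ge> 1 / 2"
        using assms fA \<open>A2 \<subseteq> pos_idx\<close> by (intro prob_sum_ge_half) auto
      then show ?thesis using dec by (simp add: H_def p)
    qed
    then have "prob (G p - (\<Union>p'\<in>P'. G p')) * (1 / 2) \<le> prob (G p - (\<Union>p'\<in>P'. G p')) * prob (H p)"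
      by (intro mult_left_mono) auto
    then show "prob (G p - (\<Union>p'\<in>{p'\<in>P. r p' < r p}. G p')) \<le> 2 * prob ((G p - (\<Union>p'\<in>{p'\<in>P. r p' < r p}. G p')) \<inter> H p)"
      using eq by (simp add: P'_def)
  qed (simp_all add: G_def H_def)
  also have "prob (\<Union>p\<in>P. G p \<inter> H p) \<le> prob (\<Union>k\<in>slab N A. {\<omega>\<in>space M. Tsum X n k \<omega> > y})"
    using finite_slab by (intro finite_measure_mono sets.finite_UN) (fastforce simp: G_def H_def P_def R_def)+
  finally have "prob (\<Union>p\<in>P. G p) \<le> 2 * prob (\<Union>k\<in>slab N A. {\<omega>\<in>space M. Tsum X n k \<omega> > y})" by simp
  moreover have "prob (\<Union>k\<in>slab N (insert a A). {\<omega>\<in>space M. Tsum X n k \<omega> > y + c}) \<le> prob (\<Union>p\<in>P. G p)"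
  proof (intro finite_measure_mono sets.finite_UN subsetI fP)
    fix \<omega> assume "\<omega> \<in> (\<Union>k\<in>slab N (insert a A). {\<omega>\<in>space M. Tsum X n k \<omega> > y + c})"
    then obtain k where k: "k \<in> slab N (insert a A)" "\<omega> \<in> space M" "Tsum X n k \<omega> > y + c" by blast
    have "(k a, k(a := N a)) \<in> P" using k(1) assms(1) by (auto simp: P_def R_def slab_def le_fun_def)
    moreover have "\<omega> \<in> G (k a, k(a := N a))" using k by (simp add: G_def kk_def)
    ultimately show "\<omega> \<in> (\<Union>p\<in>P. G p)" by blast
  qed (simp add: G_def)
  ultimately show ?thesis by simp
qed

lemma max_inequality:
  assumes "c > 0" "2 * real (absn N) * v \<le> c\<^sup>2"
  shows "prob {\<omega>\<in>space M. \<exists>k\<le>N. Tsum X n k \<omega> > y + real CARD('d) * c}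
    \<le> 2 ^ CARD('d) * prob {\<omega>\<in>space M. Tsum X n N \<omega> > y}"
proof -
  have "prob (\<Union>k\<in>slab N A. {\<omega>\<in>space M. Tsum X n k \<omega> > y + real (card A) * c})
    \<le> 2 ^ card A * prob {\<omega>\<in>space M. Tsum X n N \<omega> > y}" for A :: "'d set"
  proof (induction A rule: finite_induct[OF finite])
    case 1
    have "slab N {} = {N}" by (auto simp: slab_def)
    then show ?case by simp
  next
    case (2 a A)
    have "prob (\<Union>k\<in>slab N (insert a A). {\<omega>\<in>space M. Tsum X n k \<omega> > (y + real (card A) * c) + c})
      \<le> 2 * prob (\<Union>k\<in>slab N A. {\<omega>\<in>space M. Tsum X n k \<omega> > y + real (card A) * c})"
      using 2 assms by (intro max_inequality_step) auto
    also have "\<dots> \<le> 2 * (2 ^ card A * prob {\<omega>\<in>space M. Tsum X n N \<omega> > y})" using 2 by simp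
    finally show ?case using 2 by (simp add: algebra_simps)
  qed
  from this[of UNIV] show ?thesis
    by (rule order_trans[OF eq_refl, rotated]) (auto intro!: arg_cong[where f=prob] simp: slab_def)
qed

end

section \<open>Upper bound along the index set\<close>

text \<open>Lowering the exponent from \<open>a\<close> to \<open>p\<close> gains the factor
  \<open>x powr (a - p)\<close>, which outgrows every power of the logarithm, whatever the sign of
  \<kappa>; below a threshold the integrand is bounded.\<close>

lemma (in prob_space) integrable_powr_of_log_moment:
  fixes Y :: "'a \<Rightarrow> real"
  assumes [measurable]: "Y \<in> borel_measurable M" and "0 < p" "p < a"
    and int: "integrable M (\<lambda>\<omega>. \<bar>Y \<omega>\<bar> powr a * logplus \<bar>Y \<omega>\<bar> powr \<kappa>)"
  shows "integrable M (\<lambda>\<omega>. \<bar>Y \<omega>\<bar> powr p)"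
proof -
  define u where "u = a - p"
  have u: "u > 0" using assms by (simp add: u_def)
  then have "eventually (\<lambda>x::real. x powr u * ln x powr \<kappa> \<ge> 1) at_top" by real_asymp
  moreover have "eventually (\<lambda>x::real. ln x \<ge> 1) at_top" by real_asymp
  ultimately have "eventually (\<lambda>x::real. x powr p \<le> x powr a * logplus x powr \<kappa>) at_top"
    using eventually_gt_at_top[of 0]
  proof eventually_elim
    case (elim x)
    have "x powr p * 1 \<le> x powr p * (x powr u * ln x powr \<kappa>)" using elim by (intro mult_left_mono) auto
    also have "\<dots> = x powr a * logplus x powr \<kappa>"
      using elim by (simp add: u_def logplus_def max_def powr_add[symmetric] mult.assoc[symmetric])
    finally show ?case by simp
  qed
  then obtain x0 where x0: "\<And>x. x \<ge> x0 \<Longrightarrow> x powr p \<le> x powr a * logplus x powr \<kappa>"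
    by (auto simp: eventually_at_top_linorder)
  define x1 where "x1 = max x0 0"
  show ?thesis
  proof (rule Bochner_Integration.integrable_bound)
    show "integrable M (\<lambda>\<omega>. x1 powr p + \<bar>Y \<omega>\<bar> powr a * logplus \<bar>Y \<omega>\<bar> powr \<kappa>)" using int by auto
    have "\<bar>y\<bar> powr p \<le> x1 powr p + \<bar>y\<bar> powr a * logplus \<bar>y\<bar> powr \<kappa>" for y
    proof (cases "\<bar>y\<bar> \<ge> x1")
      case True
      then show ?thesis using x0[of "\<bar>y\<bar>"] by (simp add: x1_def add_increasing)
    next
      case False
      then have "\<bar>y\<bar> powr p \<le> x1 powr p" using assms(2) by (intro powr_mono2) auto
      then show ?thesis by (simp add: add_increasing2)
    qed
    then show "AE \<omega> in M. norm (\<bar>Y \<omega>\<bar> powr p) \<le> norm (x1 powr p + \<bar>Y \<omega>\<bar> powr a * logplus \<bar>Y \<omega>\<bar> powr \<kappa>)"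
      by (intro AE_I2) (smt (verit) real_norm_def powr_ge_zero)
  qed simp
qed

lemma (in prob_space) Markov_powr:
  fixes Y :: "'a \<Rightarrow> real"
  assumes [measurable]: "Y \<in> borel_measurable M" and "p > 0" "b > 0"
    and int: "integrable M (\<lambda>\<omega>. \<bar>Y \<omega>\<bar> powr p)"
  shows "prob {\<omega>\<in>space M. Y \<omega> > b} \<le> expectation (\<lambda>\<omega>. \<bar>Y \<omega>\<bar> powr p) / b powr p"
proof -
  have "prob {\<omega>\<in>space M. Y \<omega> > b} \<le> prob {\<omega>\<in>space M. \<bar>Y \<omega>\<bar> powr p \<ge> b powr p}"
    using assms(2,3) by (intro finite_measure_mono) (auto intro!: powr_mono2)
  also have "\<dots> \<le> expectation (\<lambda>\<omega>. \<bar>Y \<omega>\<bar> powr p) / b powr p"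
    using assms(3) by (intro integral_Markov_inequality_measure[OF int sets.top]) auto
  finally show ?thesis .
qed

lemma absn_pos: "n \<in> pos_idx \<Longrightarrow> absn n > 0"
  by (simp add: absn_def pos_idx_def prod_pos)

lemma absn_npow_le:
  assumes "n \<in> pos_idx" "0 < \<alpha>"
  shows "real (absn (npow \<alpha> n)) \<le> real (absn n) powr \<alpha>"
proof -
  have "real (absn (npow \<alpha> n)) = (\<Prod>i\<in>UNIV. real (nat \<lfloor>real (n i) powr \<alpha>\<rfloor>))"
    by (simp add: absn_def npow_def)
  also have "\<dots> \<le> (\<Prod>i\<in>UNIV. real (n i) powr \<alpha>)" by (intro prod_mono) auto
  also have "\<dots> = real (absn n) powr \<alpha>" by (simp add: absn_def prod_powr_distrib)
  finally show ?thesis .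
qed

lemma absn_ge: "n \<in> pos_idx \<Longrightarrow> n i \<le> absn n"
  unfolding absn_def by (intro dvd_imp_le dvd_prodI) (auto simp: pos_idx_def prod_pos)

context iid_field
begin

text \<open>One \<epsilon> in \<open>1 + 2 * \<epsilon>\<close> absorbs the level shift
  \<open>d * c\<close> of the maximal inequality; the other makes the exponential part decay with
  exponent \<open>(1 + \<epsilon>) * w\<close>. Truncation at order \<open>sqrt (V / L)\<close>
  costs \<open>V powr (1 - p / 2)\<close> up to logarithms, that is
  \<open>|n| powr (- (\<alpha> * (p / 2 - 1)))\<close>.\<close>

lemma max_tail_bound:
  assumes "0 < \<alpha>" "0 < w" "v < s" "0 < \<epsilon>" "2 < p" "w < \<alpha> * (p / 2 - 1)"
    and int: "integrable M (\<lambda>\<omega>. \<bar>X0 \<omega>\<bar> powr p)"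
  obtains \<rho> C m0 where "w < \<rho>" "0 < C"
    "\<And>n. n \<in> pos_idx \<Longrightarrow> m0 \<le> absn n \<Longrightarrow>
      prob {\<omega>\<in>space M. \<exists>k\<le>npow \<alpha> n. Tsum X n k \<omega>
          > (1 + 2 * \<epsilon>) * sqrt (s * w) * sqrt (2 * real (absn n) powr \<alpha> * ln (real (absn n)))}
        \<le> C * real (absn n) powr (- \<rho>)"
proof -
  have s: "s > 0" using assms(3) v_nonneg by simp
  define d where "d = real CARD('d)"
  \<comment> \<open>Half of the gap above \<open>w\<close>; it swallows the power of the logarithm
    left by the truncation.\<close>
  define e' where "e' = (\<alpha> * (p / 2 - 1) - w) / 2"
  have e': "e' > 0" using assms by (simp add: e'_def)
  define \<rho> where "\<rho> = min ((1 + \<epsilon>) * w) (\<alpha> * (p / 2 - 1) - e')"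
  have \<rho>: "w < \<rho>" using assms by (auto simp: \<rho>_def e'_def field_simps)
  define E where "E = expectation (\<lambda>\<omega>. \<bar>X0 \<omega>\<bar> powr p)"
  have E: "E \<ge> 0" by (simp add: E_def integral_nonneg_AE)
  \<comment> \<open>Makes \<open>2 - exp \<tau> = 1 / (1 + \<epsilon>)\<close>, so the correction
    from truncation undoes just one of the two factors \<open>1 + \<epsilon>\<close> in
    \<open>y\<^sup>2\<close>.\<close>
  define \<tau> where "\<tau> = ln (1 + \<epsilon> / (1 + \<epsilon>))"
  have e\<tau>: "exp \<tau> = 1 + \<epsilon> / (1 + \<epsilon>)" using assms unfolding \<tau>_def by (subst exp_ln) (auto intro: add_pos_pos)
  have \<tau>: "\<tau> > 0" unfolding \<tau>_def using assms(4) by (intro ln_gt_zero) simp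
  define c0 where "c0 = \<tau> * sqrt s / ((1 + \<epsilon>) * sqrt (2 * w))"
  have c0: "c0 > 0" using \<tau> s assms by (simp add: c0_def)
  define C where "C = 2 ^ CARD('d) * (E / c0 powr p + 1)"
  have C: "C > 0" using E c0 by (simp add: C_def add_nonneg_pos)
  have "eventually (\<lambda>m::real. ln m \<ge> (d / \<epsilon>)\<^sup>2 / w) at_top" by real_asymp
  moreover have "eventually (\<lambda>m::real. ln m powr (p / 2) \<le> m powr e') at_top" using e' by real_asymp
  ultimately have "eventually (\<lambda>m::real. ln m \<ge> (d / \<epsilon>)\<^sup>2 / w \<and> ln m powr (p / 2) \<le> m powr e' \<and> m > 1) at_top"
    using eventually_gt_at_top[of 1] by eventually_elim auto
  then obtain m1 where m1: "\<And>m::real. m \<ge> m1 \<Longrightarrow> ln m \<ge> (d / \<epsilon>)\<^sup>2 / w \<and> ln m powr (p / 2) \<le> m powr e' \<and> m > 1"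
    by (auto simp: eventually_at_top_linorder)
  have "prob {\<omega>\<in>space M. \<exists>k\<le>npow \<alpha> n. Tsum X n k \<omega>
          > (1 + 2 * \<epsilon>) * sqrt (s * w) * sqrt (2 * real (absn n) powr \<alpha> * ln (real (absn n)))}
        \<le> C * real (absn n) powr (- \<rho>)" if n: "n \<in> pos_idx" "nat \<lceil>m1\<rceil> \<le> absn n" for n
  proof -
    define m where "m = real (absn n)"
    define L where "L = ln m"
    define V where "V = m powr \<alpha>"
    have "m \<ge> m1" using n(2) by (simp add: m_def)
    then have m: "L \<ge> (d / \<epsilon>)\<^sup>2 / w" "L powr (p / 2) \<le> m powr e'" "m > 1" using m1 by (auto simp: L_def)
    have L: "L > 0" using m by (simp add: L_def)
    have V: "V > 0" using m by (simp add: V_def)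
    define N where "N = npow \<alpha> n"
    have N: "real (absn N) \<le> V" unfolding N_def V_def m_def by (rule absn_npow_le[OF n(1) assms(1)])
    \<comment> \<open>With \<open>s\<close> in place of \<open>v\<close> this stays positive when
      the variance is 0.\<close>
    define c where "c = sqrt (2 * V * s)"
    have c: "c > 0" "c\<^sup>2 = 2 * V * s" using V s by (auto simp: c_def)
    define y where "y = (1 + \<epsilon>) * sqrt (s * w) * sqrt (2 * V * L)"
    have y: "y > 0" using assms s V L by (simp add: y_def)
    have y2: "y\<^sup>2 = (1 + \<epsilon>)\<^sup>2 * w * L * (2 * V * s)"
      using s V L assms by (simp add: y_def power_mult_distrib)
    have thr: "y + d * c \<le> (1 + 2 * \<epsilon>) * sqrt (s * w) * sqrt (2 * V * L)"
    proof -
      have "(d / \<epsilon>)\<^sup>2 \<le> w * L" using m(1)[unfolded pos_divide_le_eq[OF assms(2)]] by (simp only: mult.commute)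
      then have "d / \<epsilon> \<le> sqrt (w * L)" by (rule real_le_rsqrt)
      then have "d \<le> \<epsilon> * sqrt (w * L)" using assms(4) by (simp add: field_simps)
      then have "d * c \<le> \<epsilon> * sqrt (w * L) * c" using c by (intro mult_right_mono) auto
      also have "\<dots> = \<epsilon> * sqrt (s * w) * sqrt (2 * V * L)"
        by (simp add: c_def real_sqrt_mult algebra_simps)
      finally show ?thesis by (simp add: y_def algebra_simps)
    qed
    have "2 * real (absn N) * v \<le> 2 * V * s"
      using N assms(3) v_nonneg V by (intro mult_mono) auto
    then have cN: "2 * real (absn N) * v \<le> c\<^sup>2" using c by simp
    have "prob {\<omega>\<in>space M. \<exists>k\<le>npow \<alpha> n. Tsum X n k \<omega>
          > (1 + 2 * \<epsilon>) * sqrt (s * w) * sqrt (2 * V * L)}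
        \<le> prob {\<omega>\<in>space M. \<exists>k\<le>N. Tsum X n k \<omega> > y + d * c}"
    proof (rule finite_measure_mono)
      show "{\<omega>\<in>space M. \<exists>k\<le>N. Tsum X n k \<omega> > y + d * c} \<in> events"
      proof -
        have "{\<omega>\<in>space M. \<exists>k\<le>N. Tsum X n k \<omega> > y + d * c} = (\<Union>k\<in>{k. k \<le> N}. {\<omega>\<in>space M. Tsum X n k \<omega> > y + d * c})"
          by auto
        also have "\<dots> \<in> events" by (intro sets.finite_UN finite_le_fun) auto
        finally show ?thesis .
      qed
    qed (use thr N_def in fastforce)
    also have "\<dots> \<le> 2 ^ CARD('d) * prob {\<omega>\<in>space M. Tsum X n N \<omega> > y}"
      unfolding d_def by (rule max_inequality[OF c(1) cN])
    also have "prob {\<omega>\<in>space M. Tsum X n N \<omega> > y} \<le> (E / c0 powr p + 1) * m powr (- \<rho>)"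
    proof -
      \<comment> \<open>The minimiser of the Gaussian exponent
        \<open>- t * y + V * t\<^sup>2 * s / 2\<close>; \<open>b\<close> is then the truncation
        level at which \<open>t * b\<close> equals \<tau>.\<close>
      define t where "t = y / (V * s)"
      define b where "b = \<tau> / t"
      have t: "t > 0" using y V s by (simp add: t_def)
      have b: "b > 0" using \<tau> t by (simp add: b_def)
      have tb: "t * b = \<tau>" using t by (simp add: b_def)
      have "prob {\<omega>\<in>space M. S (block n N) \<omega> > y}
        \<le> V * prob {\<omega>\<in>space M. X0 \<omega> > b} + exp (- t * y + V * (t\<^sup>2 * s * exp (t * b) / 2))"
        using t b N assms(3) by (intro upper_tail finite_block block_subset_pos_idx) (auto simp: card_block)
      also have "- t * y + V * (t\<^sup>2 * s * exp (t * b) / 2) = - ((1 + \<epsilon>) * w) * L"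
      proof -
        have "- t * y + V * (t\<^sup>2 * s * exp (t * b) / 2) = - (y\<^sup>2 / (2 * V * s)) * (2 - exp \<tau>)"
          unfolding tb unfolding t_def using V s by (simp add: field_simps power2_eq_square)
        also have "y\<^sup>2 / (2 * V * s) = (1 + \<epsilon>)\<^sup>2 * w * L" unfolding y2 using V s by simp
        also have "2 - exp \<tau> = 1 / (1 + \<epsilon>)" unfolding e\<tau> using assms(4) by (simp add: field_simps)
        finally show ?thesis using assms(4) by (simp add: power2_eq_square)
      qed
      also have "exp (- ((1 + \<epsilon>) * w) * L) = m powr (- ((1 + \<epsilon>) * w))"
        using m by (simp add: powr_def L_def)
      also have "\<dots> \<le> m powr (- \<rho>)" using m by (intro powr_mono) (auto simp: \<rho>_def)
      also have "V * prob {\<omega>\<in>space M. X0 \<omega> > b} \<le> E / c0 powr p * m powr (- \<rho>)"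
      proof -
        have bb: "b = c0 * sqrt (V / L)"
        proof -
          have "b = \<tau> * (V * s) / y" using y by (simp add: b_def t_def)
          also have "V * s = sqrt V * sqrt V * (sqrt s * sqrt s)" using V s by simp
          also have "\<tau> * \<dots> / y = c0 * sqrt (V / L)"
          proof -
            have "\<tau> * (a * a * (b * b)) / (g * (b * x) * (h * a * l)) = \<tau> * b / (g * (h * x)) * (a / l)"
              if "a > 0" "b > 0" "g > 0" "x > 0" "h > 0" "l > 0" for a b g x h l :: real
              using that by (simp add: divide_simps)
            from this[of "sqrt V" "sqrt s" "1 + \<epsilon>" "sqrt w" "sqrt 2" "sqrt L"] show ?thesis
              unfolding y_def c0_def real_sqrt_mult real_sqrt_divide using V s L assms(2,4) by simp
          qed
          finally show ?thesis .
        qed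
        have "b powr p = c0 powr p * (V / L) powr (p / 2)"
          unfolding bb using c0 V L by (simp add: powr_mult powr_half_sqrt[symmetric] powr_powr)
        also have "\<dots> = c0 powr p * (V powr (p / 2) / L powr (p / 2))" using V L by (simp add: powr_divide)
        finally have bp: "b powr p = c0 powr p * (V powr (p / 2) / L powr (p / 2))" .
        have "V * prob {\<omega>\<in>space M. X0 \<omega> > b} \<le> V * (E / b powr p)"
          unfolding E_def using V assms(5) b int by (intro mult_left_mono Markov_powr) auto
        also have "\<dots> = E / c0 powr p * (V / V powr (p / 2) * L powr (p / 2))"
          unfolding bp by simp
        also have "V / V powr (p / 2) = m powr (- (\<alpha> * (p / 2 - 1)))"
          using m by (simp add: V_def powr_powr powr_diff[symmetric] algebra_simps)
        also have "m powr (- (\<alpha> * (p / 2 - 1))) * L powr (p / 2) \<le> m powr (- (\<alpha> * (p / 2 - 1))) * m powr e'"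
          using m by (intro mult_left_mono) auto
        also have "\<dots> = m powr (- (\<alpha> * (p / 2 - 1)) + e')" by (rule powr_add[symmetric])
        also have "\<dots> \<le> m powr (- \<rho>)" using m by (intro powr_mono) (auto simp: \<rho>_def)
        finally show ?thesis using E by (simp add: mult_left_mono divide_right_mono)
      qed
      finally show ?thesis by (simp add: Tsum_eq algebra_simps)
    qed
    finally show ?thesis
      unfolding C_def m_def[symmetric] L_def[symmetric] V_def[symmetric] by (simp add: mult.assoc)
  qed
  then show ?thesis using that \<rho> C by blast
qed

end

section \<open>Almost sure upper bound along the prescribed volumes\<close>

lemma eventually_multi_at_top:
  "eventually P (multi_at_top :: ('d::finite \<Rightarrow> nat) filter) \<longleftrightarrow> (\<exists>m. \<forall>n. (\<forall>i. m \<le> n i) \<longrightarrow> P n)"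
proof -
  have "eventually P (multi_at_top :: ('d \<Rightarrow> nat) filter)
    \<longleftrightarrow> (\<exists>m\<in>UNIV. eventually P (principal {n::'d \<Rightarrow> nat. \<forall>i. m \<le> n i}))"
    unfolding multi_at_top_def
  proof (rule eventually_INF_base)
    fix a b :: nat
    show "\<exists>x\<in>UNIV. principal {n::'d \<Rightarrow> nat. \<forall>i. x \<le> n i}
      \<le> inf (principal {n. \<forall>i. a \<le> n i}) (principal {n. \<forall>i. b \<le> n i})"
      by (intro bexI[of _ "max a b"]) auto
  qed simp
  then show ?thesis by (auto simp: eventually_principal)
qed

definition ppow :: "real \<Rightarrow> nat \<Rightarrow> nat" where
  "ppow \<gamma> i = nat \<lfloor>real i powr \<gamma>\<rfloor>"

lemma ppow_le: "real (ppow \<gamma> i) \<le> real i powr \<gamma>"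
  unfolding ppow_def by (simp add: of_nat_nat)

lemma ppow_gt: "real i powr \<gamma> - 1 < real (ppow \<gamma> i)"
  unfolding ppow_def by (simp add: of_nat_nat)

lemma ppow_mono: "0 < \<gamma> \<Longrightarrow> i \<le> j \<Longrightarrow> ppow \<gamma> i \<le> ppow \<gamma> j"
  unfolding ppow_def by (intro nat_mono floor_mono powr_mono2) auto

lemma ppow_ge_half:
  assumes "0 < \<gamma>" "i \<ge> 1"
  shows "real (ppow \<gamma> i) \<ge> real i powr \<gamma> / 2" "ppow \<gamma> i \<ge> 1"
proof -
  have 1: "real i powr \<gamma> \<ge> 1" using assms by (intro ge_one_powr_ge_zero) auto
  then show ge: "ppow \<gamma> i \<ge> 1" unfolding ppow_def by (simp add: le_nat_iff)
  show "real (ppow \<gamma> i) \<ge> real i powr \<gamma> / 2"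
    using ppow_gt[of i \<gamma>] ge by (cases "real i powr \<gamma> \<ge> 2") auto
qed

text \<open>Borel-Cantelli runs over the volume index \<open>i\<close>, not over \<open>n\<close>:
  all indices of equal volume form one event \<open>U i\<close>. The gap between \<rho> and
  \<open>w\<close> is halved, one half paying for the number of indices of a given volume, the other
  for summability.\<close>

lemma (in iid_field) eventually_max_le:
  assumes "0 < \<alpha>" "0 < w" "v < s" "0 < \<epsilon>" "2 < p" "w < \<alpha> * (p / 2 - 1)"
    and int: "integrable M (\<lambda>\<omega>. \<bar>X0 \<omega>\<bar> powr p)"
  shows "AE \<omega> in M. \<forall>\<^sub>F n in inf multi_at_top (principal {n \<in> pos_idx. \<exists>i\<ge>1. absn n = ppow (1 / w) i}).
    \<forall>k\<le>npow \<alpha> n. Tsum X n k \<omega>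
      \<le> (1 + 2 * \<epsilon>) * sqrt (s * w) * sqrt (2 * real (absn n) powr \<alpha> * ln (real (absn n)))"
proof -
  define bd where "bd n = (1 + 2 * \<epsilon>) * sqrt (s * w) * sqrt (2 * real (absn n) powr \<alpha> * ln (real (absn n)))"
    for n :: "'d \<Rightarrow> nat"
  define \<gamma> where "\<gamma> = 1 / w"
  have \<gamma>: "\<gamma> > 0" using assms by (simp add: \<gamma>_def)
  obtain \<rho> C m0 where \<rho>: "w < \<rho>" "0 < C" and tail:
    "\<And>n. n \<in> pos_idx \<Longrightarrow> m0 \<le> absn n \<Longrightarrow>
      prob {\<omega>\<in>space M. \<exists>k\<le>npow \<alpha> n. Tsum X n k \<omega> > bd n} \<le> C * real (absn n) powr (- \<rho>)"
    by (rule max_tail_bound[OF assms, folded bd_def]) (rule that; blast)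
  define e where "e = (\<rho> - w) / 2"
  have e: "e > 0" using \<rho> by (simp add: e_def)
  obtain C' where C': "C' > 0"
    "\<And>m::nat. m > 0 \<Longrightarrow> real (card {n::'d \<Rightarrow> nat. absn n = m}) \<le> C' * real m powr e"
    by (rule card_absn_bound[OF e, where 'd='d]) (rule that; blast)
  define D where "D m = {n \<in> (pos_idx :: ('d \<Rightarrow> nat) set). absn n = m}" for m
  have finD: "finite (D m)" if "m > 0" for m
    using finite_absn_eq(1)[OF that, where 'd='d] by (auto simp: D_def intro: finite_subset)
  define A where "A n = {\<omega>\<in>space M. \<exists>k\<le>npow \<alpha> n. Tsum X n k \<omega> > bd n}" for n
  have A: "A n \<in> events" for n
  proof -
    have "A n = (\<Union>k\<in>{k. k \<le> npow \<alpha> n}. {\<omega>\<in>space M. Tsum X n k \<omega> > bd n})" by (auto simp: A_def)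
    also have "\<dots> \<in> events" by (intro sets.finite_UN finite_le_fun) auto
    finally show ?thesis .
  qed
  define U where "U i = (if i \<ge> 1 then (\<Union>n\<in>D (ppow \<gamma> i). A n) else {})" for i
  have pos: "ppow \<gamma> i > 0" if "i \<ge> 1" for i using ppow_ge_half(2)[OF \<gamma> that] by simp
  have U: "U i \<in> events" for i
    unfolding U_def using A finD pos by (auto intro!: sets.finite_UN)
  define r where "r = (\<rho> + w) / 2"
  have r: "r > w" "- \<rho> + e = - r" using \<rho> by (auto simp: r_def e_def field_simps)
  define K where "K = C' * C * 2 powr r"
  have bound: "prob (U i) \<le> K * real i powr (- (\<gamma> * r))" if i: "i \<ge> 1" "m0 \<le> ppow \<gamma> i" for i
  proof -
    define m where "m = ppow \<gamma> i"
    have m: "m > 0" using pos i by (simp add: m_def)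
    have "prob (U i) \<le> (\<Sum>n\<in>D m. prob (A n))"
      using i finD[OF m] A unfolding U_def m_def by (auto intro!: finite_measure_subadditive_finite)
    also have "\<dots> \<le> (\<Sum>n\<in>D m. C * real m powr (- \<rho>))"
    proof (rule sum_mono)
      fix n assume "n \<in> D m"
      then have "n \<in> pos_idx" "absn n = m" by (auto simp: D_def)
      then show "prob (A n) \<le> C * real m powr (- \<rho>)" using tail[of n] i(2) by (simp add: A_def m_def)
    qed
    also have "\<dots> = real (card (D m)) * (C * real m powr (- \<rho>))" by simp
    also have "\<dots> \<le> (C' * real m powr e) * (C * real m powr (- \<rho>))"
    proof (intro mult_right_mono)
      have "card (D m) \<le> card {n::'d \<Rightarrow> nat. absn n = m}"
        using finite_absn_eq(1)[OF m, where 'd='d] by (intro card_mono) (auto simp: D_def)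
      then show "real (card (D m)) \<le> C' * real m powr e" using C'(2)[OF m] by linarith
    qed (use \<rho> in auto)
    also have "\<dots> = C' * C * (real m powr e * real m powr (- \<rho>))" by simp
    also have "real m powr e * real m powr (- \<rho>) = real m powr (- r)"
      by (simp add: powr_add[symmetric] r(2)[symmetric] add.commute)
    also have "\<dots> \<le> (real i powr \<gamma> / 2) powr (- r)"
      using ppow_ge_half(1)[OF \<gamma> i(1)] i r assms(2) by (intro powr_mono2') (auto simp: m_def)
    also have "\<dots> = 2 powr r * real i powr (- (\<gamma> * r))"
      by (simp add: powr_divide powr_powr powr_minus) (simp only: divide_inverse)
    finally show ?thesis using C' \<rho> by (simp add: K_def mult.assoc)
  qed
  have "\<gamma> * r > 1" using r assms by (simp add: \<gamma>_def field_simps)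
  then have sumr: "summable (\<lambda>i. K * real i powr (- (\<gamma> * r)))"
    by (intro summable_mult) (simp add: summable_real_powr_iff)
  have "filterlim (\<lambda>i. real i powr \<gamma>) at_top sequentially" using \<gamma> by real_asymp
  then have "\<forall>\<^sub>F i in sequentially. real i powr \<gamma> \<ge> real m0 + 1" by (simp add: filterlim_at_top)
  then have "\<forall>\<^sub>F i in sequentially. norm (prob (U i)) \<le> K * real i powr (- (\<gamma> * r))"
    using eventually_ge_at_top[of 1]
  proof eventually_elim
    case (elim i)
    then have "real m0 < real (ppow \<gamma> i)" using ppow_gt[of i \<gamma>] by linarith
    then show ?case using bound[of i] elim by simp
  qed
  then have "summable (\<lambda>i. prob (U i))" by (rule summable_comparison_test_ev[OF _ sumr])
  then have "AE \<omega> in M. \<forall>\<^sub>F i in sequentially. \<omega> \<in> space M - U i"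
    using U by (intro borel_cantelli_AE1) (auto simp: emeasure_eq_measure)
  then show ?thesis
  proof eventually_elim
    case (elim \<omega>)
    then obtain i0 where i0: "\<And>i. i \<ge> i0 \<Longrightarrow> \<omega> \<in> space M - U i" by (auto simp: eventually_sequentially)
    have "\<forall>k\<le>npow \<alpha> n. Tsum X n k \<omega> \<le> bd n"
      if n: "\<forall>l. ppow \<gamma> i0 + 1 \<le> n l" "n \<in> pos_idx" "i \<ge> 1" "absn n = ppow \<gamma> i" for n i
    proof -
      \<comment> \<open>A single large coordinate already forces a large volume, so \<open>i\<close>
        passes the random threshold \<open>i0\<close>.\<close>
      have "ppow \<gamma> i0 + 1 \<le> ppow \<gamma> i"
        using n absn_ge[OF n(2), of undefined] by (metis order_trans)
      then have "i \<ge> i0" using ppow_mono[OF \<gamma>, of i i0] by (cases "i \<ge> i0") auto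
      from i0[OF this] have "\<omega> \<in> space M" "\<omega> \<notin> A n" using n by (auto simp: U_def D_def)
      then show ?thesis by (auto simp: A_def not_less)
    qed
    then show ?case
      unfolding eventually_inf_principal eventually_multi_at_top bd_def[symmetric] \<gamma>_def[symmetric] by blast
  qed
qed

section \<open>Lower bound along the index set\<close>

text \<open>Second Borel-Cantelli in a one-shot form: the probability that no index succeeds is at
  most the product of the \<open>1 - a i\<close>, hence at most
  \<open>exp (- (\<Sum>i\<in>K. a i))\<close> for every finite \<open>K\<close>. One success is
  enough, since the lower bound on the coordinates is raised afterwards.\<close>

lemma (in prob_space) AE_exists_of_indep:
  fixes Y :: "nat \<Rightarrow> 'a \<Rightarrow> real"
  assumes ind: "indep_vars (\<lambda>_. borel) Y L"
    and a: "\<And>i. i \<in> L \<Longrightarrow> 0 \<le> a i \<and> a i \<le> prob {\<omega>\<in>space M. Y i \<omega> > x i}"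
    and div: "\<not> summable (\<lambda>i. if i \<in> L then a i else 0)"
  shows "AE \<omega> in M. \<exists>i\<in>L. Y i \<omega> > x i"
proof -
  have Y[measurable]: "Y i \<in> borel_measurable M" if "i \<in> L" for i using ind that by (simp add: indep_vars_def)
  define Z where "Z = {\<omega>\<in>space M. \<forall>i\<in>L. Y i \<omega> \<le> x i}"
  have Z: "Z \<in> events"
  proof (cases "L = {}")
    case False
    then have "Z = (\<Inter>i\<in>L. {\<omega>\<in>space M. Y i \<omega> \<le> x i})" by (auto simp: Z_def)
    also have "\<dots> \<in> events" using False by (intro sets.countable_INT') auto
    finally show ?thesis .
  qed (simp add: Z_def)
  have fin: "prob Z \<le> exp (- (\<Sum>i\<in>K. a i))" if K: "finite K" "K \<subseteq> L" "K \<noteq> {}" for K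
  proof -
    have "prob Z \<le> prob (\<Inter>i\<in>K. Y i -` {..x i} \<inter> space M)"
      using K by (intro finite_measure_mono sets.finite_INT) (auto simp: Z_def)
    also have "\<dots> = (\<Prod>i\<in>K. prob (Y i -` {..x i} \<inter> space M))"
      using K by (intro indep_varsD[OF ind]) auto
    also have "\<dots> \<le> (\<Prod>i\<in>K. exp (- a i))"
    proof (intro prod_mono conjI)
      fix i assume i: "i \<in> K"
      then have iL: "i \<in> L" using K by auto
      note [measurable] = Y[OF iL]
      have "prob (Y i -` {..x i} \<inter> space M) = prob (space M - {\<omega>\<in>space M. Y i \<omega> > x i})"
        by (intro arg_cong[where f=prob]) auto
      also have "\<dots> = 1 - prob {\<omega>\<in>space M. Y i \<omega> > x i}" by (intro prob_compl) measurable
      also have "\<dots> \<le> 1 - a i" using a[OF iL] by simp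
      also have "\<dots> \<le> exp (- a i)" using exp_ge_add_one_self[of "- a i"] by simp
      finally show "prob (Y i -` {..x i} \<inter> space M) \<le> exp (- a i)" .
    qed simp
    also have "\<dots> = exp (- (\<Sum>i\<in>K. a i))" using K by (simp add: exp_sum[symmetric] sum_negf)
    finally show ?thesis .
  qed
  have le: "prob Z \<le> \<delta>" if "\<delta> > 0" for \<delta>
  proof -
    \<comment> \<open>The 1 forces the selected finite set to be nonempty, as the product formula
      for independent events requires.\<close>
    define R where "R = max 1 (- ln \<delta>)"
    have "\<exists>n. (\<Sum>i<n. if i \<in> L then a i else 0) > R"
    proof (rule ccontr)
      assume "\<not> ?thesis"
      then have "summable (\<lambda>i. if i \<in> L then a i else 0)"
        using a by (intro summableI_nonneg_bounded[of _ R]) (auto simp: not_less)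
      then show False using div by simp
    qed
    then obtain n where "(\<Sum>i<n. if i \<in> L then a i else 0) > R" by blast
    then have s: "(\<Sum>i\<in>L \<inter> {..<n}. a i) > R" by (simp add: sum.If_cases Int_commute)
    then have "L \<inter> {..<n} \<noteq> {}" by (auto simp: R_def)
    then have "prob Z \<le> exp (- (\<Sum>i\<in>L \<inter> {..<n}. a i))" by (intro fin) auto
    also have "\<dots> \<le> exp (ln \<delta>)" using s by (simp add: R_def)
    also have "\<dots> = \<delta>" using that by simp
    finally show ?thesis .
  qed
  have "prob Z \<le> 0"
  proof (rule field_le_epsilon)
    fix \<delta> :: real assume "0 < \<delta>"
    from le[OF this] show "prob Z \<le> 0 + \<delta>" by simp
  qed
  then have "prob Z = 0" by (simp add: measure_le_0_iff)
  then have "Z \<in> null_sets M" using Z by (auto simp: null_sets_def emeasure_eq_measure)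
  then show ?thesis by (rule AE_I') (auto simp: Z_def not_less)
qed

section \<open>Gaps between volumes and the lower bound along a ray\<close>

lemma floor_powr_ge:
  fixes \<alpha> \<zeta> :: real
  assumes "0 < \<alpha>" "\<zeta> < 1"
  obtains u0 where "\<And>u::nat. u \<ge> u0 \<Longrightarrow> \<zeta> * real u powr \<alpha> \<le> real (nat \<lfloor>real u powr \<alpha>\<rfloor>)"
proof -
  have "1 - \<zeta> > 0" using assms by simp
  then have "filterlim (\<lambda>u::nat. (1 - \<zeta>) * real u powr \<alpha>) at_top sequentially" using assms(1) by real_asymp
  then have "eventually (\<lambda>u::nat. (1 - \<zeta>) * real u powr \<alpha> \<ge> 1) sequentially" by (simp add: filterlim_at_top)
  then obtain u0 where u0: "\<And>u::nat. u \<ge> u0 \<Longrightarrow> (1 - \<zeta>) * real u powr \<alpha> \<ge> 1" by (auto simp: eventually_sequentially)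
  have "\<zeta> * real u powr \<alpha> \<le> real (nat \<lfloor>real u powr \<alpha>\<rfloor>)" if "u \<ge> u0" for u
    using u0[OF that] ppow_gt[of u \<alpha>] by (simp add: ppow_def algebra_simps)
  then show ?thesis using that by blast
qed

text \<open>The spacing, of order \<open>i powr (\<gamma> - 1)\<close>, exceeds
  \<open>i powr (\<gamma> * \<alpha>)\<close> by the factor \<open>i powr \<kappa>\<close>. For
  \<open>\<gamma> = \<beta> / (1 - \<alpha>)\<close> this exponent \<kappa> is
  \<open>\<beta> - 1\<close>, so the disjointness of the blocks comes from here.\<close>

lemma ppow_gap:
  fixes q1 :: real
  assumes "0 < \<alpha>" "\<gamma> \<ge> 1" "\<gamma> * (1 - \<alpha>) > 1" "q1 \<ge> 0"
  shows "\<forall>\<^sub>F i in sequentially. real (ppow \<gamma> i) + q1 * real (ppow \<gamma> i) powr \<alpha> \<le> real (ppow \<gamma> (Suc i))"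
proof -
  define \<kappa> where "\<kappa> = \<gamma> * (1 - \<alpha>) - 1"
  have \<kappa>: "\<kappa> > 0" using assms by (simp add: \<kappa>_def)
  then have "filterlim (\<lambda>i. real i powr \<kappa>) at_top sequentially" by real_asymp
  \<comment> \<open>One unit more than \<open>q1\<close> leaves room for the rounding in
    \<open>ppow\<close>.\<close>
  then have "\<forall>\<^sub>F i in sequentially. real i powr \<kappa> \<ge> q1 + 1" by (simp add: filterlim_at_top)
  then show ?thesis using eventually_ge_at_top[of 1]
  proof eventually_elim
    case (elim i)
    have i: "real i > 0" using elim by simp
    have "1 + 1 / real i \<le> (1 + 1 / real i) powr \<gamma>"
      using powr_mono[of 1 \<gamma> "1 + 1 / real i"] assms i by simp
    then have "real i powr \<gamma> * (1 + 1 / real i) \<le> real i powr \<gamma> * (1 + 1 / real i) powr \<gamma>"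
      by (intro mult_left_mono) auto
    also have "\<dots> = (real i * (1 + 1 / real i)) powr \<gamma>" using i by (simp add: powr_mult)
    also have "real i * (1 + 1 / real i) = real (Suc i)" using i by (simp add: field_simps)
    finally have "real i powr \<gamma> + real i powr \<gamma> / real i \<le> real (Suc i) powr \<gamma>" by (simp add: algebra_simps)
    moreover have "real i powr \<gamma> / real i = real i powr (\<gamma> * \<alpha>) * real i powr \<kappa>"
    proof -
      have "real i powr (\<gamma> * \<alpha>) * real i powr \<kappa> = real i powr (\<gamma> - 1)"
        by (simp add: powr_add[symmetric] \<kappa>_def algebra_simps)
      then show ?thesis using i by (simp add: powr_diff)
    qed
    moreover have "real i powr (\<gamma> * \<alpha>) * real i powr \<kappa> \<ge> real i powr (\<gamma> * \<alpha>) * (q1 + 1)"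
      using elim by (intro mult_left_mono) auto
    moreover have "real i powr (\<gamma> * \<alpha>) \<ge> 1" using elim assms by (intro ge_one_powr_ge_zero) auto
    ultimately have 1: "real i powr \<gamma> + q1 * real i powr (\<gamma> * \<alpha>) + 1 \<le> real (Suc i) powr \<gamma>"
      by (simp add: algebra_simps)
    have "real (ppow \<gamma> i) powr \<alpha> \<le> (real i powr \<gamma>) powr \<alpha>"
      using ppow_le assms by (intro powr_mono2) auto
    then have "q1 * real (ppow \<gamma> i) powr \<alpha> \<le> q1 * real i powr (\<gamma> * \<alpha>)"
      using assms by (intro mult_left_mono) (auto simp: powr_powr)
    then show ?case using 1 ppow_le[of \<gamma> i] ppow_gt[of "Suc i" \<gamma>] by linarith
  qed
qed

text \<open>With all coordinates but one frozen, membership in the index set becomes divisibility of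
  \<open>ppow \<gamma> i\<close> by a constant, and distinct summation blocks are eventually disjoint.\<close>

definition ray :: "'d \<Rightarrow> nat \<Rightarrow> nat \<Rightarrow> ('d::finite \<Rightarrow> nat)" where
  "ray a m u = (\<lambda>l. if l = a then u else m)"

lemma prod_ray: "(\<Prod>l\<in>UNIV. f (ray a m u l)) = f u * (f m :: 'a::comm_monoid_mult) ^ (CARD('d) - 1)"
  for a :: "'d::finite"
proof -
  have "(\<Prod>l\<in>UNIV. f (ray a m u l)) = f u * (\<Prod>l\<in>UNIV - {a}. f (ray a m u l))"
    by (subst prod.remove[of UNIV a]) (auto simp: ray_def)
  also have "(\<Prod>l\<in>UNIV - {a}. f (ray a m u l)) = (\<Prod>l\<in>UNIV - {a}. f m)"
    by (intro prod.cong) (auto simp: ray_def)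
  finally show ?thesis by simp
qed

lemma absn_ray: "absn (ray a m u) = u * m ^ (CARD('d) - 1)" for a :: "'d::finite"
  unfolding absn_def using prod_ray[of "\<lambda>x. x" a m u] by simp

lemma absn_npow_ray:
  "absn (npow \<alpha> (ray a m u)) = nat \<lfloor>real u powr \<alpha>\<rfloor> * nat \<lfloor>real m powr \<alpha>\<rfloor> ^ (CARD('d) - 1)"
  for a :: "'d::finite"
  unfolding absn_def npow_def using prod_ray[of "\<lambda>x. nat \<lfloor>real x powr \<alpha>\<rfloor>" a m u] by simp

text \<open>The squared level carries two factors \<open>1 - \<epsilon>\<close>: one pays for the
  rounded volume of the block, the other lowers \<theta> below \<open>w\<close> so that the loss
  \<open>1 + \<eta>\<close> of the tail bound restores exactly \<open>w\<close>. As
  \<open>ppow \<gamma> i powr (- w) \<ge> 1 / i\<close>, divergence reduces to that of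
  \<open>1 / i\<close> over the divisible \<open>i\<close>.\<close>

lemma (in iid_field) AE_exists_large:
  fixes \<alpha> w \<epsilon> :: real and m :: nat
  assumes "0 < \<alpha>" "\<alpha> < 1" "0 < w" "w < 1 - \<alpha>" "v > 0" "0 < \<epsilon>" "\<epsilon> < 1"
  shows "AE \<omega> in M. \<exists>n\<in>{n \<in> pos_idx. \<exists>i\<ge>1. absn n = ppow (1 / w) i}. (\<forall>l. m \<le> n l) \<and>
    Tsum X n (npow \<alpha> n) \<omega> > (1 - \<epsilon>) * sqrt (v * w) * sqrt (2 * real (absn n) powr \<alpha> * ln (real (absn n)))"
proof -
  define a :: 'd where "a = undefined"
  define d where "d = CARD('d)"
  have d: "d > 0" by (simp add: d_def)
  define \<gamma> where "\<gamma> = 1 / w"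
  have \<gamma>: "\<gamma> > 1" "\<gamma> * (1 - \<alpha>) > 1" using assms by (auto simp: \<gamma>_def field_simps)
  have \<gamma>0: "\<gamma> > 0" using \<gamma> by simp
  \<comment> \<open>Each of the \<open>d\<close> sides keeps at least the fraction \<zeta> after
    rounding, hence the volume keeps \<open>\<zeta> ^ d = 1 - \<epsilon>\<close>.\<close>
  define \<zeta> where "\<zeta> = (1 - \<epsilon>) powr (1 / real d)"
  have "\<zeta> powr 1 < 1 powr 1" unfolding \<zeta>_def using assms d powr_less_mono2[of "1 / real d" "1 - \<epsilon>" 1] by simp
  then have \<zeta>: "0 < \<zeta>" "\<zeta> < 1" using assms by (auto simp: \<zeta>_def)
  have \<zeta>d: "\<zeta> ^ d = 1 - \<epsilon>"
    using assms d by (simp add: \<zeta>_def powr_power)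
  obtain u0 where u0: "\<And>u::nat. u \<ge> u0 \<Longrightarrow> \<zeta> * real u powr \<alpha> \<le> real (nat \<lfloor>real u powr \<alpha>\<rfloor>)"
    using floor_powr_ge[OF assms(1) \<zeta>(2)] by metis
  define m1 where "m1 = max (max m u0) 1"
  have m1: "m1 \<ge> m" "m1 \<ge> u0" "m1 \<ge> 1" by (auto simp: m1_def)
  define q where "q = m1 ^ (d - 1)"
  have q: "q > 0" using m1 by (simp add: q_def)
  define H where "H = {i. q dvd ppow \<gamma> i}"
  define n where "n i = (ray a m1 (ppow \<gamma> i div q) :: 'd \<Rightarrow> nat)" for i
  have absn_n: "absn (n i) = ppow \<gamma> i" if "i \<in> H" for i
    using that by (simp add: n_def absn_ray H_def q_def d_def)
  define \<theta> where "\<theta> = (1 - \<epsilon>) * w"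
  have \<theta>: "\<theta> > 0" using assms by (simp add: \<theta>_def)
  define \<eta> where "\<eta> = 1 / (1 - \<epsilon>) - 1"
  have \<eta>: "\<eta> > 0" "(1 + \<eta>) * \<theta> = w" using assms by (auto simp: \<eta>_def \<theta>_def field_simps)
  have "infinite (pos_idx :: ('d \<Rightarrow> nat) set)"
  proof -
    have "inj (\<lambda>k::nat. (\<lambda>_. Suc k) :: 'd \<Rightarrow> nat)" by (auto simp: inj_def fun_eq_iff)
    then have "infinite (range (\<lambda>k::nat. (\<lambda>_. Suc k) :: 'd \<Rightarrow> nat))" by (rule range_inj_infinite)
    moreover have "range (\<lambda>k::nat. (\<lambda>_. Suc k) :: 'd \<Rightarrow> nat) \<subseteq> pos_idx" by (auto simp: pos_idx_def)
    ultimately show ?thesis using infinite_super by blast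
  qed
  from lower_tail[OF this assms(5) \<theta> \<eta>(1)] obtain C \<kappa> N0 where C: "C > 0" "\<kappa> > 0" and tail:
    "\<And>J L. finite J \<Longrightarrow> J \<subseteq> pos_idx \<Longrightarrow> N0 \<le> card J \<Longrightarrow> 0 \<le> L \<Longrightarrow> L \<le> \<kappa> * real (card J) \<Longrightarrow>
      C * exp (- (1 + \<eta>) * \<theta> * L) \<le> prob {\<omega>\<in>space M. S J \<omega> > sqrt (2 * \<theta> * v * real (card J) * L)}"
    by blast
  have ppow_top: "filterlim (\<lambda>i. real (ppow \<gamma> i)) at_top sequentially"
  proof (rule filterlim_at_top_mono)
    show "filterlim (\<lambda>i. real i powr \<gamma> - 1) at_top sequentially" using \<gamma>0 by real_asymp
    show "\<forall>\<^sub>F i in sequentially. real i powr \<gamma> - 1 \<le> real (ppow \<gamma> i)"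
      using ppow_gt by (intro always_eventually allI less_imp_le)
  qed
  have "\<forall>\<^sub>F x::real in at_top. real N0 \<le> (1 - \<epsilon>) * x powr \<alpha>" using assms by real_asymp
  moreover have "\<forall>\<^sub>F x::real in at_top. ln x \<le> \<kappa> * ((1 - \<epsilon>) * x powr \<alpha>)" using assms C by real_asymp
  ultimately have "\<forall>\<^sub>F x::real in at_top. real N0 \<le> (1 - \<epsilon>) * x powr \<alpha> \<and> ln x \<le> \<kappa> * ((1 - \<epsilon>) * x powr \<alpha>)
      \<and> x \<ge> 1 \<and> x \<ge> real q * real m1"
    using eventually_ge_at_top[of 1] eventually_ge_at_top[of "real q * real m1"] by eventually_elim auto
  then have ev1: "\<forall>\<^sub>F i in sequentially. real N0 \<le> (1 - \<epsilon>) * real (ppow \<gamma> i) powr \<alpha>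
      \<and> ln (real (ppow \<gamma> i)) \<le> \<kappa> * ((1 - \<epsilon>) * real (ppow \<gamma> i) powr \<alpha>)
      \<and> real (ppow \<gamma> i) \<ge> 1 \<and> real (ppow \<gamma> i) \<ge> real q * real m1"
    using ppow_top unfolding filterlim_iff by blast
  have ev2: "\<forall>\<^sub>F i in sequentially. real (ppow \<gamma> i) + real q * real (ppow \<gamma> i) powr \<alpha> \<le> real (ppow \<gamma> (Suc i))"
    using assms \<gamma> by (intro ppow_gap) auto
  obtain i0 where i0: "\<And>i. i \<ge> i0 \<Longrightarrow> real N0 \<le> (1 - \<epsilon>) * real (ppow \<gamma> i) powr \<alpha>"
    "\<And>i. i \<ge> i0 \<Longrightarrow> ln (real (ppow \<gamma> i)) \<le> \<kappa> * ((1 - \<epsilon>) * real (ppow \<gamma> i) powr \<alpha>)"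
    "\<And>i. i \<ge> i0 \<Longrightarrow> real (ppow \<gamma> i) \<ge> 1" "\<And>i. i \<ge> i0 \<Longrightarrow> real (ppow \<gamma> i) \<ge> real q * real m1"
    "\<And>i. i \<ge> i0 \<Longrightarrow> real (ppow \<gamma> i) + real q * real (ppow \<gamma> i) powr \<alpha> \<le> real (ppow \<gamma> (Suc i))"
    using eventually_conj[OF ev1 ev2] by (auto simp: eventually_sequentially)
  define L where "L = {i \<in> H. i \<ge> i0 \<and> i \<ge> 1}"
  define Bx where "Bx i = block (n i) (npow \<alpha> (n i))" for i
  have na: "n i a = ppow \<gamma> i div q" for i by (simp add: n_def ray_def)
  have div_ge: "ppow \<gamma> i div q \<ge> m1" if "i \<ge> i0" for i
  proof -
    have "real (m1 * q) \<le> real (ppow \<gamma> i)" using i0(4)[OF that] by (simp add: mult.commute)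
    then have "m1 * q \<le> ppow \<gamma> i" by (simp only: of_nat_le_iff)
    then show ?thesis using q by (simp add: less_eq_div_iff_mult_less_eq)
  qed
  have n_ge: "n i l \<ge> m1" if "i \<ge> i0" for i l using div_ge[OF that] by (simp add: n_def ray_def)
  have n_pos: "n i \<in> pos_idx" if "i \<ge> i0" for i
  proof -
    have "0 < n i l" for l using n_ge[OF that, of l] m1(3) by linarith
    then show ?thesis by (simp add: pos_idx_def)
  qed
  define xx where "xx i = (1 - \<epsilon>) * sqrt (v * w) * sqrt (2 * real (ppow \<gamma> i) powr \<alpha> * ln (real (ppow \<gamma> i)))" for i
  have prob_ge: "C / real i \<le> prob {\<omega>\<in>space M. S (Bx i) \<omega> > xx i}" if "i \<in> L" for i
  proof -
    have i: "i \<in> H" "i \<ge> i0" "i \<ge> 1" using that by (auto simp: L_def)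
    define x where "x = real (ppow \<gamma> i)"
    define u where "u = ppow \<gamma> i div q"
    have x: "x \<ge> 1" using i0(3)[OF i(2)] by (simp add: x_def)
    have xq: "x = real u * real q" using i(1) by (simp add: x_def u_def H_def flip: of_nat_mult)
    define N where "N = card (Bx i)"
    have "real N = real (nat \<lfloor>real u powr \<alpha>\<rfloor>) * real (nat \<lfloor>real m1 powr \<alpha>\<rfloor>) ^ (d - 1)"
      by (simp add: N_def Bx_def card_block n_def absn_npow_ray u_def d_def)
    also have "\<dots> \<ge> (\<zeta> * real u powr \<alpha>) * (\<zeta> * real m1 powr \<alpha>) ^ (d - 1)"
      using u0[of u] u0[of m1] m1 div_ge[OF i(2)] \<zeta> by (intro mult_mono power_mono) (auto simp: u_def)
    also have "(\<zeta> * real u powr \<alpha>) * (\<zeta> * real m1 powr \<alpha>) ^ (d - 1) = \<zeta> ^ d * x powr \<alpha>"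
    proof -
      have "\<zeta> ^ d = \<zeta> * \<zeta> ^ (d - 1)" using d by (cases d) auto
      moreover have "real q powr \<alpha> = (real m1 powr \<alpha>) ^ (d - 1)"
        using m1 by (simp add: q_def powr_power powr_realpow[symmetric] powr_powr mult.commute)
      ultimately show ?thesis unfolding xq by (simp add: powr_mult power_mult_distrib)
    qed
    finally have N: "(1 - \<epsilon>) * x powr \<alpha> \<le> real N" using \<zeta>d by simp
    have lnx: "0 \<le> ln x" using x by simp
    have "real N0 \<le> real N" using i0(1)[OF i(2)] N by (simp add: x_def)
    moreover have "ln x \<le> \<kappa> * real N"
      using order_trans[OF i0(2)[OF i(2)] mult_left_mono[OF N[unfolded x_def], of \<kappa>]] C by (simp add: x_def)
    ultimately have "C * exp (- (1 + \<eta>) * \<theta> * ln x) \<le> prob {\<omega>\<in>space M. S (Bx i) \<omega> > sqrt (2 * \<theta> * v * real N * ln x)}"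
      unfolding N_def using lnx by (intro tail) (auto simp: Bx_def block_subset_pos_idx)
    also have "\<dots> \<le> prob {\<omega>\<in>space M. S (Bx i) \<omega> > xx i}"
    proof -
      have "xx i = sqrt ((1 - \<epsilon>)\<^sup>2 * (v * w) * (2 * x powr \<alpha> * ln x))"
        unfolding xx_def x_def[symmetric] using assms by (simp add: real_sqrt_mult)
      also have "\<dots> \<le> sqrt (2 * \<theta> * v * real N * ln x)"
      proof (rule real_sqrt_le_mono)
        have "(1 - \<epsilon>)\<^sup>2 * (v * w) * (2 * x powr \<alpha> * ln x) = (2 * \<theta> * v * ln x) * ((1 - \<epsilon>) * x powr \<alpha>)"
          by (simp add: \<theta>_def power2_eq_square)
        also have "\<dots> \<le> (2 * \<theta> * v * ln x) * real N"
          using N \<theta> assms(5) lnx by (intro mult_left_mono) auto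
        finally show "(1 - \<epsilon>)\<^sup>2 * (v * w) * (2 * x powr \<alpha> * ln x) \<le> 2 * \<theta> * v * real N * ln x"
          by (simp add: mult_ac)
      qed
      finally have "xx i \<le> sqrt (2 * \<theta> * v * real N * ln x)" .
      then show ?thesis using S_meas[of "Bx i"]
        by (intro finite_measure_mono) (auto simp: Bx_def block_subset_pos_idx)
    qed
    finally have 1: "C * exp (- (1 + \<eta>) * \<theta> * ln x) \<le> prob {\<omega>\<in>space M. S (Bx i) \<omega> > xx i}" .
    have "1 / real i = (real i powr \<gamma>) powr (- w)"
      using i assms by (simp add: powr_powr \<gamma>_def powr_minus divide_inverse)
    also have "\<dots> \<le> x powr (- w)"
      using ppow_le[of \<gamma> i] x assms by (intro powr_mono2') (auto simp: x_def)
    also have "\<dots> = exp (- (1 + \<eta>) * \<theta> * ln x)"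
      using x unfolding \<eta>(2)[symmetric] by (simp add: powr_def algebra_simps)
    finally have "C * (1 / real i) \<le> C * exp (- (1 + \<eta>) * \<theta> * ln x)" using C by (intro mult_left_mono) auto
    then show ?thesis using 1 by simp
  qed
  have disj: "disjoint_family_on Bx L"
  proof -
    \<comment> \<open>Projecting to coordinate \<open>a\<close> and scaling by \<open>q\<close>
      turns disjointness into the gap between consecutive volumes.\<close>
    have *: "Bx i \<inter> Bx j = {}" if "i \<in> L" "j \<in> L" "i < j" for i j
    proof -
      have i: "i \<in> H" "i \<ge> i0" and j: "j \<in> H" using that by (auto simp: L_def)
      define x where "x = real (ppow \<gamma> i)"
      have x: "x \<ge> 1" using i0(3)[OF i(2)] by (simp add: x_def)
      have "npow \<alpha> (n i) a = nat \<lfloor>real (ppow \<gamma> i div q) powr \<alpha>\<rfloor>" by (simp add: npow_def na)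
      then have "real (npow \<alpha> (n i) a) \<le> real (ppow \<gamma> i div q) powr \<alpha>" by simp
      also have "\<dots> \<le> x powr \<alpha>" unfolding x_def using assms by (intro powr_mono2) (auto simp: div_le_dividend)
      finally have np: "real (npow \<alpha> (n i) a) \<le> x powr \<alpha>" .
      have qi: "real q * real (n i a) = x" using i by (simp add: na H_def x_def flip: of_nat_mult)
      have qj: "real q * real (n j a) = real (ppow \<gamma> j)" using j by (simp add: na H_def flip: of_nat_mult)
      have "real q * real (n i a + npow \<alpha> (n i) a) = x + real q * real (npow \<alpha> (n i) a)"
        using qi by (simp add: distrib_left)
      also have "\<dots> \<le> x + real q * x powr \<alpha>" using np by (intro add_left_mono mult_left_mono) auto
      also have "\<dots> \<le> real (ppow \<gamma> (Suc i))" using i0(5)[OF i(2)] by (simp add: x_def)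
      also have "\<dots> \<le> real (ppow \<gamma> j)" using ppow_mono[OF \<gamma>0, of "Suc i" j] that by simp
      also have "\<dots> = real q * real (n j a)" using qj by simp
      finally have "n i a + npow \<alpha> (n i) a \<le> n j a" using q by simp
      then show ?thesis unfolding Bx_def block_def
        by (auto dest!: spec[of _ a])
    qed
    show ?thesis unfolding disjoint_family_on_def
    proof (intro ballI impI)
      fix i j assume "i \<in> L" "j \<in> L" "i \<noteq> j"
      then show "Bx i \<inter> Bx j = {}" using *[of i j] *[of j i] by (cases "i < j") auto
    qed
  qed
  have "AE \<omega> in M. \<exists>i\<in>L. S (Bx i) \<omega> > xx i"
  proof (rule AE_exists_of_indep)
    have "indep_vars (\<lambda>i. PiM (Bx i) (\<lambda>_. borel)) (\<lambda>i \<omega>. \<lambda>j\<in>Bx i. X j \<omega>) L"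
      by (rule indep_vars_restrict[OF indep _ disj]) (simp add: Bx_def block_subset_pos_idx)
    from indep_vars_compose2[OF this, of "\<lambda>i f. \<Sum>j\<in>Bx i. f j" "\<lambda>_. borel"]
    show "indep_vars (\<lambda>_. borel) (\<lambda>i. S (Bx i)) L"
      by (simp cong: sum.cong)
    show "0 \<le> C / real i \<and> C / real i \<le> prob {\<omega>\<in>space M. S (Bx i) \<omega> > xx i}" if "i \<in> L" for i
      using prob_ge[OF that] C by simp
    show "\<not> summable (\<lambda>i. if i \<in> L then C / real i else 0)"
    proof
      assume "summable (\<lambda>i. if i \<in> L then C / real i else 0)"
      then have "summable (\<lambda>i. 1 / C * (if i \<in> L then C / real i else 0))" by (rule summable_mult)
      moreover have "\<forall>\<^sub>F i in sequentially. 1 / C * (if i \<in> L then C / real i else 0)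
        = (if q dvd nat \<lfloor>real i powr \<gamma>\<rfloor> then 1 / real i else 0)"
        using eventually_ge_at_top[of "max i0 1"]
        by eventually_elim (use C in \<open>auto simp: L_def H_def ppow_def\<close>)
      ultimately have "summable (\<lambda>i. if q dvd nat \<lfloor>real i powr \<gamma>\<rfloor> then 1 / real i else 0)"
        by (subst (asm) summable_cong) auto
      then show False using not_summable_dvd_floor_powr[OF \<gamma>0 q] by simp
    qed
  qed
  then show ?thesis
  proof eventually_elim
    case (elim \<omega>)
    then obtain i where i: "i \<in> L" "S (Bx i) \<omega> > xx i" by blast
    then have iH: "i \<in> H" "i \<ge> i0" "i \<ge> 1" by (auto simp: L_def)
    show ?case
    proof (intro bexI[of _ "n i"] conjI)
      show "\<forall>l. m \<le> n i l" using n_ge[OF iH(2)] m1(1) order_trans by blast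
      show "(1 - \<epsilon>) * sqrt (v * w) * sqrt (2 * real (absn (n i)) powr \<alpha> * ln (real (absn (n i)))) < Tsum X (n i) (npow \<alpha> (n i)) \<omega>"
        using i(2) absn_n[OF iH(1)] by (simp add: xx_def Tsum_eq Bx_def)
      show "n i \<in> {n \<in> pos_idx. \<exists>i\<ge>1. absn n = ppow (1 / w) i}"
        using n_pos[OF iH(2)] absn_n[OF iH(1)] iH(3) by (auto simp: \<gamma>_def)
    qed
  qed
qed

section \<open>The limit superior\<close>

text \<open>Needed for variance 0, where the lower bound is 0: the limsup along a trivial filter
  would be minus infinity. Non-summability shows that there are infinitely many divisible
  indices.\<close>

lemma exists_large_index:
  assumes "\<gamma> > 0"
  shows "\<exists>n\<in>{n \<in> (pos_idx :: ('d::finite \<Rightarrow> nat) set). \<exists>i\<ge>1. absn n = ppow \<gamma> i}. \<forall>l. m \<le> n l"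
proof -
  define m1 where "m1 = max m 1"
  define q where "q = m1 ^ (CARD('d) - 1)"
  have "m1 > 0" by (simp add: m1_def)
  then have q: "q > 0" by (simp add: q_def)
  define H where "H = {i. q dvd ppow \<gamma> i}"
  have "infinite H"
  proof
    assume "finite H"
    then have "summable (\<lambda>i. if q dvd nat \<lfloor>real i powr \<gamma>\<rfloor> then 1 / real i else 0)"
      by (rule summable_finite) (auto simp: H_def ppow_def)
    then show False using not_summable_dvd_floor_powr[OF assms q] by simp
  qed
  have "filterlim (\<lambda>i. real i powr \<gamma>) at_top sequentially" using assms by real_asymp
  then have "\<forall>\<^sub>F i in sequentially. real i powr \<gamma> \<ge> real (m1 * q) + 1" by (simp only: filterlim_at_top)
  then obtain i0 where i0: "\<And>i. i \<ge> i0 \<Longrightarrow> real i powr \<gamma> \<ge> real (m1 * q) + 1" by (auto simp: eventually_sequentially)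
  obtain i where i: "i \<in> H" "i \<ge> max i0 1"
    using \<open>infinite H\<close> by (metis infinite_nat_iff_unbounded_le)
  have "real (m1 * q) < real (ppow \<gamma> i)" using i0[of i] i ppow_gt[of i \<gamma>] by simp
  then have "m1 * q \<le> ppow \<gamma> i" by (simp only: of_nat_less_iff)
  then have u: "m1 \<le> ppow \<gamma> i div q" using q by (simp add: less_eq_div_iff_mult_less_eq)
  define n where "n = (ray undefined m1 (ppow \<gamma> i div q) :: 'd \<Rightarrow> nat)"
  have ge: "m1 \<le> n l" for l using u by (simp add: n_def ray_def)
  have "absn n = ppow \<gamma> i" using i by (simp add: n_def absn_ray H_def q_def)
  moreover have "m \<le> n l" "0 < n l" for l using ge[of l] by (auto simp: m1_def)
  ultimately show ?thesis using i by (intro bexI[of _ n]) (auto simp: pos_idx_def)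
qed

lemma le_Limsup_multi:
  fixes f :: "('d::finite \<Rightarrow> nat) \<Rightarrow> ereal"
  assumes "\<And>m. \<exists>n\<in>B. (\<forall>l. m \<le> n l) \<and> c \<le> f n"
  shows "c \<le> Limsup (inf multi_at_top (principal B)) f"
proof (rule ccontr)
  assume "\<not> ?thesis"
  then have "\<forall>\<^sub>F n in inf multi_at_top (principal B). f n < c" by (intro Limsup_lessD) simp
  then obtain m where m: "\<And>n. \<forall>l. m \<le> n l \<Longrightarrow> n \<in> B \<Longrightarrow> f n < c"
    unfolding eventually_inf_principal eventually_multi_at_top by blast
  from assms[of m] obtain n where "n \<in> B" "\<forall>l. m \<le> n l" "c \<le> f n" by blast
  with m[of n] show False by simp
qed

theorem theorem7p2:
  fixes M :: "'w measure"
    and X :: "('d::finite \<Rightarrow> nat) \<Rightarrow> 'w \<Rightarrow> real"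
    and X0 :: "'w \<Rightarrow> real"
    and \<alpha> \<beta> \<sigma> :: real
    and B :: "('d \<Rightarrow> nat) set"
  assumes "prob_space M"
    and "CARD('d) \<ge> 2"
    and "0 < \<alpha>" and "\<alpha> < 1" and "\<beta> > 1"
    and "X0 \<in> borel_measurable M"
    and "\<And>n. n \<in> pos_idx \<Longrightarrow> X n \<in> borel_measurable M"
    and "prob_space.indep_vars M (\<lambda>_. borel) X pos_idx"
    and "\<And>n. n \<in> pos_idx \<Longrightarrow> distr M borel (X n) = distr M borel X0"
    and "integrable M X0" and "(\<integral>\<omega>. X0 \<omega> \<partial>M) = 0"
    and "integrable M (\<lambda>\<omega>. (X0 \<omega>)\<^sup>2)"
    and "\<sigma> = sqrt (\<integral>\<omega>. (X0 \<omega>)\<^sup>2 \<partial>M)"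
    and "integrable M (\<lambda>\<omega>. \<bar>X0 \<omega>\<bar> powr (2 / \<alpha>)
            * logplus \<bar>X0 \<omega>\<bar> powr (real CARD('d) - 1 - 1 / \<alpha>))"
    and "B = {n \<in> pos_idx. \<exists>i::nat. i \<ge> 1 \<and>
            absn n = nat \<lfloor>real i powr (\<beta> / (1 - \<alpha>))\<rfloor>}"
  shows "AE \<omega> in M.
    Limsup (inf multi_at_top (principal B))
      (\<lambda>n. ereal (Max ((\<lambda>k. Tsum X n k \<omega>) ` {k. k \<le> npow \<alpha> n})
               / sqrt (2 * real (absn n) powr \<alpha> * ln (real (absn n)))))
    = ereal (\<sigma> * sqrt ((1 - \<alpha>) / \<beta>))"
proof -
  interpret prob_space M by (rule assms(1))
  interpret iid_field M X X0
    by unfold_locales (use assms in auto)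
  define w where "w = (1 - \<alpha>) / \<beta>"
  have w: "0 < w" "w < 1 - \<alpha>" using assms(3-5) by (auto simp: w_def divide_less_eq)
  have B: "B = {n \<in> pos_idx. \<exists>i\<ge>1. absn n = ppow (1 / w) i}"
    unfolding assms(15) ppow_def w_def by simp
  define F where "F = inf multi_at_top (principal B)"
  define D where "D n = sqrt (2 * real (absn n) powr \<alpha> * ln (real (absn n)))" for n :: "'d \<Rightarrow> nat"
  define T where "T \<omega> n = Max ((\<lambda>k. Tsum X n k \<omega>) ` {k. k \<le> npow \<alpha> n})" for \<omega> n
  define r where "r = sqrt (v * w)"
  have r: "\<sigma> * sqrt ((1 - \<alpha>) / \<beta>) = r"
    unfolding r_def assms(13) v_def w_def by (rule real_sqrt_mult[symmetric])
  have D_nonneg: "0 \<le> D n" if "n \<in> B" for n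
  proof -
    have "absn n > 0" using that absn_pos by (auto simp: B)
    then show ?thesis by (simp add: D_def)
  qed
  have D_pos: "0 < D n" if "n \<in> B" "\<forall>l. 2 \<le> n l" for n
  proof -
    have "2 \<le> absn n" using that absn_ge[of n undefined] by (auto simp: B intro: order_trans)
    then show ?thesis by (simp add: D_def)
  qed
  have T_ge: "Tsum X n k \<omega> \<le> T \<omega> n" if "k \<le> npow \<alpha> n" for n k \<omega>
    unfolding T_def using that by (intro Max_ge) auto
  \<comment> \<open>The box contains \<open>k = 0\<close>, whose sum is empty.\<close>
  have T_nonneg: "0 \<le> T \<omega> n" for \<omega> n
  proof -
    have "{j::'d \<Rightarrow> nat. \<forall>i. n i < j i \<and> j i \<le> n i + 0} = {}" using leD by auto
    then have "Tsum X n (\<lambda>_. 0) \<omega> = 0" unfolding Tsum_def by (simp only: sum.empty)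
    then show ?thesis using T_ge[of "\<lambda>_. 0" n \<omega>] by (simp add: le_fun_def)
  qed

  \<comment> \<open>Makes \<open>\<alpha> * (p / 2 - 1)\<close> the midpoint of \<open>w\<close> and
    \<open>1 - \<alpha>\<close>, the latter being its value at
    \<open>p = 2 / \<alpha>\<close>.\<close>
  define p where "p = 1 + (1 + w) / \<alpha>"
  have p: "2 < p" "p < 2 / \<alpha>" "w < \<alpha> * (p / 2 - 1)"
  proof -
    have e: "p - 2 = (1 + w - \<alpha>) / \<alpha>" "2 / \<alpha> - p = (1 - \<alpha> - w) / \<alpha>"
      "\<alpha> * (p / 2 - 1) = (1 + w - \<alpha>) / 2"
      using assms(3) by (simp_all add: p_def field_simps)
    have "(1 + w - \<alpha>) / \<alpha> > 0" "(1 - \<alpha> - w) / \<alpha> > 0" using assms(3) w by auto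
    then show "2 < p" "p < 2 / \<alpha>" using e(1,2) by linarith+
    show "w < \<alpha> * (p / 2 - 1)" unfolding e(3) using w by simp
  qed
  have int_p: "integrable M (\<lambda>\<omega>. \<bar>X0 \<omega>\<bar> powr p)"
    using p by (intro integrable_powr_of_log_moment[OF assms(6) _ _ assms(14)]) auto
  \<comment> \<open>Both slacks, \<epsilon> and \<open>s - v\<close>, shrink along one sequence, so
    countably many null sets suffice.\<close>
  define hi where "hi k = (1 + 2 * (1 / real (Suc k))) * sqrt ((v + 1 / real (Suc k)) * w)" for k
  have "hi \<longlonglongrightarrow> (1 + 2 * 0) * sqrt ((v + 0) * w)"
    unfolding hi_def by (intro tendsto_intros LIMSEQ_Suc[OF lim_1_over_n])
  then have hi_lim: "(\<lambda>k. ereal (hi k)) \<longlonglongrightarrow> ereal r" by (simp add: r_def)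
  have hi_nonneg: "0 \<le> hi k" for k unfolding hi_def using v_nonneg w by simp
  have "AE \<omega> in M. \<forall>\<^sub>F n in F. \<forall>j\<le>npow \<alpha> n. Tsum X n j \<omega> \<le> hi k * D n" for k
    unfolding F_def B hi_def D_def
    using assms(3) w p int_p by (intro eventually_max_le) auto
  then have "AE \<omega> in M. \<forall>k. \<forall>\<^sub>F n in F. \<forall>j\<le>npow \<alpha> n. Tsum X n j \<omega> \<le> hi k * D n"
    unfolding AE_all_countable by simp
  then have upper: "AE \<omega> in M. Limsup F (\<lambda>n. ereal (T \<omega> n / D n)) \<le> ereal r"
  proof eventually_elim
    case (elim \<omega>)
    have "Limsup F (\<lambda>n. ereal (T \<omega> n / D n)) \<le> ereal (hi k)" for k
    proof (rule Limsup_bounded)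
      have "\<forall>\<^sub>F n in F. n \<in> B" unfolding F_def by (simp add: eventually_inf_principal)
      moreover have "\<forall>\<^sub>F n in F. \<forall>j\<le>npow \<alpha> n. Tsum X n j \<omega> \<le> hi k * D n" using elim by simp
      ultimately show "\<forall>\<^sub>F n in F. ereal (T \<omega> n / D n) \<le> ereal (hi k)"
      proof eventually_elim
        case (elim n)
        have "T \<omega> n \<le> hi k * D n"
          unfolding T_def using elim(2) by (subst Max_le_iff) auto
        \<comment> \<open>\<open>D n\<close> vanishes for \<open>|n| = 1\<close>, where the quotient
          is 0 by convention; there the claim reduces to \<open>hi k \<ge> 0\<close>.\<close>
        then show ?case using D_nonneg[OF elim(1)] hi_nonneg[of k]
          by (cases "D n = 0") (auto simp: pos_divide_le_eq)
      qed
    qed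
    then show ?case using LIMSEQ_le_const[OF hi_lim] by blast
  qed

  have lower: "AE \<omega> in M. ereal r \<le> Limsup F (\<lambda>n. ereal (T \<omega> n / D n))"
  proof (cases "v > 0")
    case True
    \<comment> \<open>\<open>Suc (Suc k)\<close> keeps the relative loss strictly below 1.\<close>
    define lo where "lo k = (1 - 1 / real (Suc (Suc k))) * r" for k
    have "lo \<longlonglongrightarrow> (1 - 0) * r"
      unfolding lo_def by (intro tendsto_intros LIMSEQ_Suc[OF LIMSEQ_Suc[OF lim_1_over_n]])
    then have lo_lim: "(\<lambda>k. ereal (lo k)) \<longlonglongrightarrow> ereal r" by simp
    have "AE \<omega> in M. \<exists>n\<in>B. (\<forall>l. m \<le> n l) \<and> Tsum X n (npow \<alpha> n) \<omega> > lo k * D n" for m k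
      unfolding B lo_def r_def D_def
      using assms(3,4) w True by (intro AE_exists_large) auto
    then have "AE \<omega> in M. \<forall>k m. \<exists>n\<in>B. (\<forall>l. m \<le> n l) \<and> Tsum X n (npow \<alpha> n) \<omega> > lo k * D n"
      unfolding AE_all_countable by simp
    then show ?thesis
    proof eventually_elim
      case (elim \<omega>)
      have "ereal (lo k) \<le> Limsup F (\<lambda>n. ereal (T \<omega> n / D n))" for k
        unfolding F_def
      proof (rule le_Limsup_multi)
        fix m
        \<comment> \<open>Coordinates of at least 2 make \<open>D n\<close> positive, so the
          inequality can be divided by it.\<close>
        obtain n where n: "n \<in> B" "\<forall>l. max m 2 \<le> n l" "Tsum X n (npow \<alpha> n) \<omega> > lo k * D n"
          using elim by blast
        have "lo k * D n \<le> T \<omega> n" using n(3) T_ge[of "npow \<alpha> n" n \<omega>] by simp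
        then show "\<exists>n\<in>B. (\<forall>l. m \<le> n l) \<and> ereal (lo k) \<le> ereal (T \<omega> n / D n)"
          using n(1,2) D_pos[of n] by (intro bexI[of _ n]) (auto simp: pos_le_divide_eq)
      qed
      then show ?case using LIMSEQ_le_const2[OF lo_lim] by blast
    qed
  next
    case False
    then have r0: "r = 0" using v_nonneg by (simp add: r_def)
    show ?thesis
    proof (intro AE_I2, unfold F_def, rule le_Limsup_multi)
      fix \<omega> m
      obtain n where "n \<in> B" "\<forall>l. m \<le> n l" using exists_large_index[of "1 / w" m] w unfolding B by auto
      then show "\<exists>n\<in>B. (\<forall>l. m \<le> n l) \<and> ereal r \<le> ereal (T \<omega> n / D n)"
        using T_nonneg D_nonneg by (intro bexI[of _ n]) (auto simp: r0)
    qed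
  qed
  from upper lower show ?thesis
    unfolding r F_def[symmetric] D_def[symmetric] T_def[symmetric] by eventually_elim (rule antisym)
qed

end
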